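(* Let the shear modulus $\mu>0$ of an incompressible neo-Hookean unit cube be a random variable with Gamma density $g(u;\rho_1,\rho_2)=\frac{u^{\rho_1-1}e^{-u/\rho_2}}{\rho_2^{\rho_1}\Gamma(\rho_1)}$, $u>0$, where $\rho_1,\rho_2>0$, and let $\tau>0$ be a given equitriaxial dead load. Then, up to events of probability zero, exactly one of the following three outcomes occurs: (1) $\tau<3\mu/2^{2/3}$, i.e. $\mu>2^{2/3}\tau/3$, in which case the reference state is the only equilibrium and is stable (one possible equilibrium); (2) $0<2\mu<\tau$, i.e. $0<\mu<\tau/2$, in which case the reference state is unstable and there are two non-trivial equilibria, given by the two solutions $\lambda\neq1$, $\lambda>0$, of $\tau=\mu\left(\lambda+\frac1{\sqrt\lambda}\right)$ (two possible equilibria); (3) $3\mu/2^{2/3}<\tau<2\mu$, i.e. $\tau/2<\mu<2^{2/3}\tau/3$, in which case the stable reference state and two such non-trivial equilibria co-exist (three possible equilibria). The probabilities of having one, two and three possible equilibria are, respectively, $$P_1(\tau)=1-\int_0^{2^{2/3}\tau/3}g(u;\rho_1,\rho_2)\,du,\qquad P_2(\tau)=\int_0^{\tau/2}g(u;\rho_1,\rho_2)\,du,$$ $$P_3(\tau)=1-P_1(\tau)-P_2(\tau)=\int_{\tau/2}^{2^{2/3}\tau/3}g(u;\rho_1,\rho_2)\,du.$$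
   Context: Setting. The body occupies $V=(0,1)^3$ in the reference configuration. For a fixed value of $\mu$, the neo-Hookean strain-energy function is $\mathcal W(\lambda_1,\lambda_2,\lambda_3)=\frac{\mu}{2}(\lambda_1^2+\lambda_2^2+\lambda_3^2-3)$, where $\lambda_i>0$ are the principal stretches (singular values) of the deformation gradient $\mathbf F$; write $W(\mathbf F)=\mathcal W(\lambda_1,\lambda_2,\lambda_3)$. The material is incompressible: $\det\mathbf F=1$. The total free energy of a deformation $\mathbf x:V\to\mathbb R^3$ with $\nabla\mathbf x=\mathbf F$ is $E(\mathbf x)=\int_V[W(\mathbf F)-\tau\,\mathrm{tr}(\mathbf F)]\,dV$. Equilibria. Only homogeneous triaxial stretches $\nabla\mathbf x=\mathrm{diag}(\lambda_1,\lambda_2,\lambda_3)$, $\lambda_i>0$ constant, $\lambda_1\lambda_2\lambda_3=1$, are considered. Such a stretch is an equilibrium under dead load $\tau$ if there is a constant $p\in\mathbb R$ with $-\frac{p}{\lambda_i}+\mu\lambda_i=\tau$ for $i=1,2,3$. The reference state is $\lambda_1=\lambda_2=\lambda_3=1$. Equilibria are counted up to permutation of the three axes; non-trivial ones are of the form $(\lambda,\lambda^{-1/2},\lambda^{-1/2})$ with $\lambda\ne1$ and are counted by the value of $\lambda$. In the count of "possible equilibria" the reference state is counted only when it is stable. Stability. A deformation $\mathbf x$ with $\det\nabla\mathbf x=1$ is stable if $E(\mathbf x)<E(\mathbf y)$ for all continuous, piecewise differentiable deformations $\mathbf y$ of $V$ with $\det\nabla\mathbf y=1$, $\nabla\mathbf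 y\not\equiv\nabla\mathbf x$, and $\sup_V|\nabla\mathbf y-\nabla\mathbf x|$ sufficiently small; it is unstable if not even the non-strict inequality $E(\mathbf x)\le E(\mathbf y)$ holds for all such $\mathbf y$. *)

theory Defs
  imports "HOL-Probability.Probability" "HOL-Combinatorics.Permutations"
begin

definition gamma_density :: "real \<Rightarrow> real \<Rightarrow> real \<Rightarrow> real" where
  "gamma_density r1 r2 u =
     (if 0 < u then u powr (r1 - 1) * exp (- u / r2) / (r2 powr r1 * Gamma r1) else 0)"

definition body :: "(real ^ 3) set" where
  "body = {X. \<forall>i. 0 < X $ i \<and> X $ i < 1}"

text \<open>The singular values of \<open>F\<close>, with multiplicity: their squares are the roots of the
  characteristic polynomial of \<open>F\<^sup>T F\<close>. They are positive as soon as \<open>det F = 1\<close>. Their order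
  is left open, which is harmless because the strain energy is symmetric in its arguments.\<close>

definition is_singular_values :: "real ^ 3 ^ 3 \<Rightarrow> real ^ 3 \<Rightarrow> bool" where
  "is_singular_values F l \<longleftrightarrow>
     (\<forall>i. 0 \<le> l $ i) \<and>
     (\<forall>t. det (mat t - transpose F ** F) = (\<Prod>i\<in>UNIV. t - (l $ i)\<^sup>2))"

definition principal_stretches :: "real ^ 3 ^ 3 \<Rightarrow> real ^ 3" where
  "principal_stretches F = (SOME l. is_singular_values F l)"

definition neo_hookean :: "real \<Rightarrow> real \<Rightarrow> real \<Rightarrow> real \<Rightarrow> real" where
  "neo_hookean mu l1 l2 l3 = mu / 2 * (l1\<^sup>2 + l2\<^sup>2 + l3\<^sup>2 - 3)"

definition strain_energy :: "real \<Rightarrow> real ^ 3 ^ 3 \<Rightarrow> real" where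
  "strain_energy mu F =
     (let l = principal_stretches F in neo_hookean mu (l $ 1) (l $ 2) (l $ 3))"

abbreviation grad :: "(real ^ 3 \<Rightarrow> real ^ 3) \<Rightarrow> real ^ 3 \<Rightarrow> real ^ 3 ^ 3" where
  "grad y X \<equiv> jacobian y (at X)"

definition diff_points :: "(real ^ 3 \<Rightarrow> real ^ 3) \<Rightarrow> (real ^ 3) set" where
  "diff_points y = {X \<in> body. y differentiable (at X)}"

text \<open>The integrand is only meaningful on \<^term>\<open>diff_points y\<close>, which has full measure in
  the body for the deformations considered; the complete measure \<^term>\<open>lebesgue\<close> makes the
  values on the remaining null set irrelevant.\<close>

definition total_energy :: "real \<Rightarrow> real \<Rightarrow> (real ^ 3 \<Rightarrow> real ^ 3) \<Rightarrow> real" where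
  "total_energy mu tau y =
     (\<integral>X\<in>body. (strain_energy mu (grad y X) - tau * trace (grad y X)) \<partial>lebesgue)"

text \<open>Piecewise: up to a null set (the interfaces), the body is split into finitely many
  subdomains.\<close>

definition piecewise_differentiable :: "(real ^ 3 \<Rightarrow> real ^ 3) \<Rightarrow> bool" where
  "piecewise_differentiable y \<longleftrightarrow>
     (\<exists>P. finite P \<and> disjoint P \<and>
          (\<forall>D\<in>P. open D \<and> connected D \<and> D \<subseteq> body \<and> (\<forall>X\<in>D. y differentiable (at X))) \<and>
          negligible (body - \<Union>P))"

definition admissible :: "(real ^ 3 \<Rightarrow> real ^ 3) \<Rightarrow> bool" where
  "admissible y \<longleftrightarrow>
     continuous_on body y \<and> piecewise_differentiable y \<and>
     (\<forall>X\<in>diff_points y. det (grad y X) = 1)"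

definition competitors ::
    "(real ^ 3 \<Rightarrow> real ^ 3) \<Rightarrow> real \<Rightarrow> (real ^ 3 \<Rightarrow> real ^ 3) set" where
  "competitors x e =
     {y. admissible y \<and>
         (\<exists>X\<in>diff_points x \<inter> diff_points y. grad y X \<noteq> grad x X) \<and>
         (\<forall>X\<in>diff_points x \<inter> diff_points y. norm (grad y X - grad x X) \<le> e)}"

definition stable_deformation :: "real \<Rightarrow> real \<Rightarrow> (real ^ 3 \<Rightarrow> real ^ 3) \<Rightarrow> bool" where
  "stable_deformation mu tau x \<longleftrightarrow>
     admissible x \<and>
     (\<exists>e>0. \<forall>y\<in>competitors x e. total_energy mu tau x < total_energy mu tau y)"

definition unstable_deformation :: "real \<Rightarrow> real \<Rightarrow> (real ^ 3 \<Rightarrow> real ^ 3) \<Rightarrow> bool" where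
  "unstable_deformation mu tau x \<longleftrightarrow>
     admissible x \<and>
     \<not> (\<exists>e>0. \<forall>y\<in>competitors x e. total_energy mu tau x \<le> total_energy mu tau y)"

definition triaxial :: "real ^ 3 \<Rightarrow> real ^ 3 \<Rightarrow> real ^ 3" where
  "triaxial l = (\<lambda>X. \<chi> i. l $ i * X $ i)"

definition reference :: "real ^ 3" where
  "reference = (\<chi> i. 1)"

definition equilibria :: "real \<Rightarrow> real \<Rightarrow> (real ^ 3) set" where
  "equilibria mu tau =
     {l. (\<forall>i. 0 < l $ i) \<and> (\<Prod>i\<in>UNIV. l $ i) = 1 \<and>
         (\<exists>p. \<forall>i. - p / l $ i + mu * l $ i = tau)}"

definition axis_permutation :: "((real ^ 3) \<times> (real ^ 3)) set" where
  "axis_permutation = {(l, m). \<exists>\<pi>. \<pi> permutes UNIV \<and> m = (\<chi> i. l $ \<pi> i)}"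

text \<open>The load parameters \<open>\<lambda> \<noteq> 1\<close> of the stretches \<open>(\<lambda>, \<lambda>\<^sup>-\<^sup>1\<^sup>/\<^sup>2, \<lambda>\<^sup>-\<^sup>1\<^sup>/\<^sup>2)\<close>.\<close>

definition solutions :: "real \<Rightarrow> real \<Rightarrow> real set" where
  "solutions mu tau = {x. 0 < x \<and> x \<noteq> 1 \<and> tau = mu * (x + 1 / sqrt x)}"

definition uniaxial :: "real \<Rightarrow> real ^ 3" where
  "uniaxial x = vector [x, x powr (- 1 / 2), x powr (- 1 / 2)]"

definition two_nontrivial_equilibria :: "real \<Rightarrow> real \<Rightarrow> bool" where
  "two_nontrivial_equilibria mu tau \<longleftrightarrow>
     card (solutions mu tau) = 2 \<and>
     card ((equilibria mu tau - {reference}) // axis_permutation) = 2 \<and>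
     (equilibria mu tau - {reference}) // axis_permutation =
       (\<lambda>x. axis_permutation `` {uniaxial x}) ` solutions mu tau"

definition possible_equilibria :: "real \<Rightarrow> real \<Rightarrow> (real ^ 3) set" where
  "possible_equilibria mu tau =
     {l \<in> equilibria mu tau. l = reference \<longrightarrow> stable_deformation mu tau (triaxial reference)}"

definition num_possible_equilibria :: "real \<Rightarrow> real \<Rightarrow> nat" where
  "num_possible_equilibria mu tau = card (possible_equilibria mu tau // axis_permutation)"

end

(* Write F = I + H with det F = 1, and let S and K be the symmetric and skew parts of H. Since
   det F = 1 forces tr H = (tr(H^2) - (tr H)^2)/2 - det H, the energy density exceeds that of the
   reference state by (2 mu - tau)/2 |S|^2 + tau/2 |K|^2 + O(|H|^3), so for tau < 2 mu every
   competitor with small gradient has a pointwise larger density; equality almost everywhere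
   would force the competitor to be a translation. For tau > 2 mu small plane strains release
   energy. The stretches of an equilibrium are roots of one quadratic equation, so a non-trivial
   one has exactly two equal stretches, and x + x^(-1/2) = tau/mu is solved by studying
   s^2 + 1/s, which decreases and then increases, with minimum 3/2^(2/3) at s = 2^(-1/3).
   Only two values of mu separate the three regimes, and they are null for the Gamma law. *)
theory Submission
  imports Defs
begin

subsection \<open>The strain energy in terms of the Frobenius norm\<close>

text \<open>The integrated energy gap controls the gradient of a competitor only up to a null set,
  whereas a competitor may differ from the reference gradient at a single point of
  differentiability. What closes this is a rigidity statement: a gradient equal to the identity
  almost everywhere, together with differentiability at every point of each piece, forces a
  translation. Gradients are not assumed continuous, so the proof integrates along segments with the
  gauge integral, which recovers a function from any derivative that exists everywhere. A second
  obstacle is that the energy is defined through a chosen triple of singular values; existence of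
  such a triple has to be proved before the energy can be rewritten with the Frobenius norm. On the
  probabilistic side, the number of equilibria is known only off the two thresholds, so its level
  sets are compared with intervals modulo a finite set, which yields measurability and probability
  together.\<close>

lemma prod_UNIV_3: "prod f (UNIV :: 3 set) = f 1 * f 2 * f 3"
  unfolding UNIV_3 by (simp add: mult.assoc)

lemma cubic_real_root:
  fixes a b c :: real
  obtains t where "t^3 + a * t^2 + b * t + c = 0"
proof -
  let ?p = "\<lambda>t::real. t^3 + a * t^2 + b * t + c"
  \<comment> \<open>At \<open>-m\<close> and \<open>m\<close> the leading term dominates: since
    \<open>m\<close> is at least 1, the lower-order terms are at most (m - 1) m^2, which fixes both
    signs.\<close>
  define m where "m = 1 + \<bar>a\<bar> + \<bar>b\<bar> + \<bar>c\<bar>"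
  have m: "m \<ge> 1" by (simp add: m_def)
  have bound: "\<bar>a * m^2\<bar> + \<bar>b * m\<bar> + \<bar>c\<bar> \<le> m^3"
  proof -
    have "m \<le> m^2" "1 \<le> m^2"
      using m by (auto simp: power2_eq_square intro: order_trans[OF m])
    then have "\<bar>b\<bar> * m \<le> \<bar>b\<bar> * m^2" "\<bar>c\<bar> * 1 \<le> \<bar>c\<bar> * m^2"
      by (intro mult_left_mono; simp)+
    then have "\<bar>a * m^2\<bar> + \<bar>b * m\<bar> + \<bar>c\<bar> \<le> (\<bar>a\<bar> + \<bar>b\<bar> + \<bar>c\<bar>) * m^2"
      using m by (simp add: abs_mult algebra_simps)
    also have "\<dots> \<le> m * m^2" by (rule mult_right_mono) (auto simp: m_def)
    finally show ?thesis by (simp add: power3_eq_cube power2_eq_square algebra_simps)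
  qed
  have "?p (-m) \<le> 0" "0 \<le> ?p m"
    using bound by (auto simp: power3_eq_cube power2_eq_square)
  moreover have "continuous_on {-m..m} ?p" by (intro continuous_intros)
  ultimately obtain t where "?p t = 0"
    using IVT'[of ?p "-m" 0 m] m by auto
  then show ?thesis using that by blast
qed

lemma charpoly_cubic:
  fixes A :: "real^3^3"
  obtains a b c where "\<And>t. det (mat t - A) = t^3 + a * t^2 + b * t + c" "a = - trace A"
proof
  show "det (mat t - A) = t^3 + (- trace A) * t^2 +
     (A$1$1 * A$2$2 + A$1$1 * A$3$3 + A$2$2 * A$3$3 - A$1$2 * A$2$1 - A$1$3 * A$3$1 - A$2$3 * A$3$2) * t
     + (- det A)" for t
    by (simp add: det_3 mat_def trace_def sum_3 algebra_simps power3_eq_cube power2_eq_square)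
qed auto

lemma eigenvalue_root:
  fixes A :: "real^3^3"
  assumes "det (mat t - A) = 0"
  obtains v where "norm v = 1" "A *v v = t *\<^sub>R v"
proof -
  have "\<not> (\<exists>B. B ** (mat t - A) = mat 1)"
    using assms by (metis invertible_det_nz invertible_left_inverse)
  then obtain v where v: "(mat t - A) *v v = 0" "v \<noteq> 0"
    by (auto simp: matrix_left_invertible_ker)
  have "mat t *v v = t *\<^sub>R v"
    by (simp add: vec_eq_iff matrix_vector_mult_def mat_def if_distrib if_distribR sum.delta' cong: if_cong)
  then have "A *v v = t *\<^sub>R v" using v by (simp add: matrix_vector_mult_diff_rdistrib)
  then show ?thesis
    using v that[of "v /\<^sub>R norm v"] by (simp add: matrix_vector_mult_scaleR)
qed

text \<open>The left side is the characteristic polynomial of the symmetric 2 x 2 matrix with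
  diagonal \<open>p\<close>, \<open>q\<close> and off-diagonal entry \<open>r\<close>; its
  discriminant is a sum of squares.\<close>

lemma real_quadratic_roots:
  fixes p q r :: real
  obtains x y where "\<And>t. (t - p) * (t - q) - r^2 = (t - x) * (t - y)"
proof
  define s where "s = sqrt ((p - q)^2 + 4 * r^2)"
  have "s^2 = (p - q)^2 + 4 * r^2" by (simp add: s_def)
  then show "(t - p) * (t - q) - r^2 = (t - (p + q + s) / 2) * (t - (p + q - s) / 2)" for t
    by (simp add: field_simps power2_eq_square)
qed

lemma matrix_diff_ldistrib:
  fixes A :: "real^'n^'m" and B C :: "real^'k^'n"
  shows "A ** (B - C) = A ** B - A ** C"
  by (simp add: vec_eq_iff matrix_matrix_mult_def sum_subtractf right_diff_distrib)

lemma matrix_diff_rdistrib: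
  fixes A B :: "real^'n^'m" and C :: "real^'k^'n"
  shows "(A - B) ** C = A ** C - B ** C"
  by (simp add: vec_eq_iff matrix_matrix_mult_def sum_subtractf left_diff_distrib)

text \<open>Deflation: an orthogonal change of basis moves one eigenvector to the first axis, and
  symmetry clears the first row along with the first column. A symmetric 2 x 2 block remains. The
  result concerns the polynomial because \<open>is_singular_values\<close> speaks of roots, not of
  eigenvectors.\<close>

lemma symmetric_charpoly_splits:
  fixes A :: "real^3^3"
  assumes sym: "transpose A = A"
  obtains r :: "real^3" where "\<And>t. det (mat t - A) = (\<Prod>i\<in>UNIV. t - r $ i)"
proof -
  obtain a b c where "\<And>t. det (mat t - A) = t^3 + a * t^2 + b * t + c"
    by (rule charpoly_cubic) blast
  moreover obtain l where "l^3 + a * l^2 + b * l + c = 0" by (rule cubic_real_root)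
  ultimately have "det (mat l - A) = 0" by simp
  then obtain v where v: "norm v = 1" "A *v v = l *\<^sub>R v" by (rule eigenvalue_root)
  obtain R where R: "orthogonal_matrix R" "R *v axis 1 1 = v"
    using orthogonal_matrix_exists_basis[OF v(1)] by metis
  define B where "B = transpose R ** A ** R"
  have RR: "transpose R ** R = mat 1" using R by (simp add: orthogonal_matrix_def)
  have Bsym: "transpose B = B"
    by (simp add: B_def matrix_transpose_mul matrix_mul_assoc sym)
  have "B *v axis 1 1 = l *\<^sub>R (transpose R *v v)"
    by (simp add: B_def R v matrix_vector_mul_assoc[symmetric] matrix_vector_mult_scaleR)
  also have "transpose R *v v = axis 1 1"
    by (simp add: R(2)[symmetric] matrix_vector_mul_assoc RR)
  finally have col: "B $ i $ 1 = l * axis 1 1 $ i" for i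
    by (simp add: vec_eq_iff matrix_vector_mult_basis column_def)
  have B: "B $ 1 $ 1 = l" "B$2$1 = 0" "B$3$1 = 0" "B$1$2 = 0" "B$1$3 = 0" "B$2$3 = B$3$2"
    using col[of 1] col[of 2] col[of 3] Bsym
    by (auto simp: axis_def vec_eq_iff transpose_def)
  have "det (mat t - A) = det (mat t - B)" for t
  proof -
    have "transpose R ** mat t ** R = mat t"
    proof -
      have "(mat t :: real^3^3) = t *\<^sub>R mat 1" by (simp add: mat_def vec_eq_iff)
      then show ?thesis using RR by (simp add: matrix_scalar_ac scalar_matrix_assoc[symmetric])
    qed
    then have "mat t - B = transpose R ** (mat t - A) ** R"
      by (simp add: B_def matrix_diff_ldistrib matrix_diff_rdistrib)
    moreover have "det (transpose R) * det R = 1" by (metis RR det_I det_mul)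
    ultimately show ?thesis by (simp add: det_mul)
  qed
  moreover obtain x y where xy: "\<And>t. (t - B$2$2) * (t - B$3$3) - (B$3$2)^2 = (t - x) * (t - y)"
    by (rule real_quadratic_roots) blast
  moreover have "det (mat t - B) = (t - l) * ((t - B$2$2) * (t - B$3$3) - (B$3$2)^2)" for t
    by (simp add: det_3 B mat_def algebra_simps power2_eq_square)
  ultimately have "det (mat t - A) = (\<Prod>i\<in>UNIV. t - (vector [l, x, y] :: real^3) $ i)" for t
    by (simp add: prod_UNIV_3 vector_3)
  then show ?thesis using that by blast
qed

text \<open>\<open>principal_stretches\<close> is a \<open>SOME\<close> term, so its value is usable
  only once a witness exists. An eigenvalue of F^T F with unit eigenvector v equals |F v|^2, hence
  has a real square root.\<close>

lemma ex_singular_values: "\<exists>l. is_singular_values F l"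
proof -
  let ?A = "transpose F ** F"
  have "transpose ?A = ?A" by (simp add: matrix_transpose_mul)
  then obtain r :: "real^3" where r: "\<And>t. det (mat t - ?A) = (\<Prod>i\<in>UNIV. t - r $ i)"
    using symmetric_charpoly_splits by blast
  have "0 \<le> r $ i" for i
  proof -
    have "det (mat (r $ i) - ?A) = 0" by (auto simp: r)
    then obtain v where v: "norm v = 1" "?A *v v = (r $ i) *\<^sub>R v" using eigenvalue_root by blast
    have "r $ i = v \<bullet> (?A *v v)" by (simp add: v dot_square_norm)
    also have "\<dots> = ((F *v v) v* F) \<bullet> v"
      by (simp add: matrix_vector_mul_assoc[symmetric] inner_commute)
    also have "\<dots> = (F *v v) \<bullet> (F *v v)" by (rule dot_lmul_matrix)
    finally show ?thesis by simp
  qed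
  then have "is_singular_values F (\<chi> i. sqrt (r $ i))"
    by (simp add: is_singular_values_def r)
  then show ?thesis by blast
qed

lemma norm_matrix_eq: "(norm (F :: real^3^3))\<^sup>2 = trace (transpose F ** F)"
  unfolding power2_norm_eq_inner
  by (simp add: inner_vec_def trace_def matrix_matrix_mult_def transpose_def sum_3)

lemma strain_energy_eq: "strain_energy mu F = mu / 2 * ((norm F)\<^sup>2 - 3)"
proof -
  let ?A = "transpose F ** F"
  define l where "l = principal_stretches F"
  have l: "is_singular_values F l"
    unfolding l_def principal_stretches_def by (rule someI_ex[OF ex_singular_values])
  obtain a b c where p: "\<And>t. det (mat t - ?A) = t^3 + a * t^2 + b * t + c" "a = - trace ?A"
    using charpoly_cubic by blast
  have "t^3 + a * t^2 + b * t + c = (t - (l$1)\<^sup>2) * (t - (l$2)\<^sup>2) * (t - (l$3)\<^sup>2)" for t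
    using l p by (simp add: is_singular_values_def prod_UNIV_3)
  \<comment> \<open>For a monic cubic p, the combination p(1) + p(-1) - 2 p(0) is twice the
    coefficient of t^2, so three evaluations identify that coefficient.\<close>
  from this[of 1] this[of "-1"] this[of 0] have "a = - ((l$1)\<^sup>2 + (l$2)\<^sup>2 + (l$3)\<^sup>2)"
    by (simp add: algebra_simps)
  then show ?thesis
    using p by (simp add: strain_energy_def Let_def l_def[symmetric] neo_hookean_def norm_matrix_eq)
qed

subsection \<open>The energy gap near the identity\<close>

lemma abs_triple_le:
  fixes x y z e :: real
  assumes "\<bar>x\<bar> \<le> e"
  shows "\<bar>x * y * z\<bar> \<le> e * (y\<^sup>2 + z\<^sup>2) / 2"
proof -
  have "2 * \<bar>y * z\<bar> \<le> y\<^sup>2 + z\<^sup>2"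
    using sum_squares_bound[of "\<bar>y\<bar>" "\<bar>z\<bar>"] by (simp add: abs_mult)
  then have "\<bar>x\<bar> * (2 * \<bar>y * z\<bar>) \<le> e * (y\<^sup>2 + z\<^sup>2)"
    using assms by (intro mult_mono) auto
  then show ?thesis by (simp add: abs_mult mult.assoc)
qed

text \<open>The determinant of I + H is 1 + tr H + ((tr H)^2 - tr(H^2))/2 + det H, so the constraint
  makes tr H a second-order quantity. Here \<open>q\<close> is tr(H^2), the genuine second-order
  term, and \<open>d\<close> is det H. The bounds show that \<open>d\<close> and (tr H)^2 are of
  third order and can be absorbed for small \<open>e\<close>.\<close>

lemma isochoric_expansion:
  fixes H :: "real^3^3"
  assumes det: "det (mat 1 + H) = 1" and H: "norm H \<le> e" and e: "e \<le> 1"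
  obtains q d where "trace H = - ((trace H)\<^sup>2 / 2 - q / 2 + d)"
    "\<bar>q\<bar> \<le> (norm H)\<^sup>2" "\<bar>d\<bar> \<le> 3 * e * (norm H)\<^sup>2" "(trace H)\<^sup>2 \<le> 15 * e * (norm H)\<^sup>2"
proof -
  let ?n = "(norm H)\<^sup>2" and ?t = "trace H"
  let ?h = "\<lambda>i j. H $ i $ j"
  have ent: "\<bar>?h i j\<bar> \<le> e" for i j
    using Finite_Cartesian_Product.norm_nth_le[of "H $ i" j] Finite_Cartesian_Product.norm_nth_le[of H i] H by simp
  then have e0: "0 \<le> e" by (meson abs_ge_zero order_trans)
  define q where "q = trace (H ** H)"
  define d where "d = det H"
  have q: "q = (?h 1 1)\<^sup>2 + (?h 2 2)\<^sup>2 + (?h 3 3)\<^sup>2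
    + 2 * ?h 1 2 * ?h 2 1 + 2 * ?h 1 3 * ?h 3 1 + 2 * ?h 2 3 * ?h 3 2"
    by (simp add: q_def trace_def matrix_matrix_mult_def sum_3 power2_eq_square)
  have n: "?n = (?h 1 1)\<^sup>2 + (?h 1 2)\<^sup>2 + (?h 1 3)\<^sup>2 + (?h 2 1)\<^sup>2 + (?h 2 2)\<^sup>2 + (?h 2 3)\<^sup>2
     + (?h 3 1)\<^sup>2 + (?h 3 2)\<^sup>2 + (?h 3 3)\<^sup>2"
    unfolding power2_norm_eq_inner by (simp add: inner_vec_def sum_3 power2_eq_square)
  have t: "?t = ?h 1 1 + ?h 2 2 + ?h 3 3" by (simp add: trace_def sum_3)
  have expand: "?t = - (?t\<^sup>2 / 2 - q / 2 + d)"
  proof -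
    have "2 * ?t = - (?t\<^sup>2 - q + 2 * d)"
      using det unfolding q t d_def by (simp add: det_3 mat_def algebra_simps power2_eq_square)
    then show ?thesis by simp
  qed
  have ql: "\<bar>q\<bar> \<le> ?n"
  proof -
    have ub: "2 * x * y \<le> x\<^sup>2 + y\<^sup>2" and lb: "- (2 * x * y) \<le> x\<^sup>2 + y\<^sup>2" for x y :: real
      using sum_squares_bound[of x y] sum_squares_bound[of x "- y"] by auto
    note z = zero_le_power2[of "?h 1 1"] zero_le_power2[of "?h 2 2"] zero_le_power2[of "?h 3 3"]
    show ?thesis
    proof (rule abs_leI)
      show "q \<le> ?n"
        using ub[of "?h 1 2" "?h 2 1"] ub[of "?h 1 3" "?h 3 1"] ub[of "?h 2 3" "?h 3 2"]
        unfolding q n by linarith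
      show "- q \<le> ?n"
        using lb[of "?h 1 2" "?h 2 1"] lb[of "?h 1 3" "?h 3 1"] lb[of "?h 2 3" "?h 3 2"] z
        unfolding q n by linarith
    qed
  qed
  have dl: "\<bar>d\<bar> \<le> 3 * e * ?n"
  proof -
    have d: "d = ?h 1 1 * ?h 2 2 * ?h 3 3 + ?h 1 2 * ?h 2 3 * ?h 3 1 + ?h 1 3 * ?h 2 1 * ?h 3 2
      - ?h 1 1 * ?h 2 3 * ?h 3 2 - ?h 1 2 * ?h 2 1 * ?h 3 3 - ?h 1 3 * ?h 2 2 * ?h 3 1"
      by (simp add: d_def det_3)
    \<comment> \<open>In each product of the determinant one entry is bounded by \<open>e\<close>;
      the other two sit at different positions, so their squares are distinct summands of the
      squared norm.\<close>
    have b: "\<bar>?h i j * ?h k l * ?h m p\<bar> \<le> e * ?n / 2"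
      if "(k, l) \<noteq> (m, p)" for i j k l m p
    proof -
      have "(?h k l)\<^sup>2 + (?h m p)\<^sup>2 \<le> ?n"
        using that exhaust_3[of k] exhaust_3[of l] exhaust_3[of m] exhaust_3[of p]
        unfolding n by auto
      then show ?thesis
        using abs_triple_le[OF ent, of i j "?h k l" "?h m p"] e0
        by (smt (verit) divide_right_mono mult_left_mono)
    qed
    have six: "\<bar>a1 + a2 + a3 - a4 - a5 - a6\<bar> \<le> 6 * k"
      if "\<bar>a1\<bar> \<le> k" "\<bar>a2\<bar> \<le> k" "\<bar>a3\<bar> \<le> k" "\<bar>a4\<bar> \<le> k" "\<bar>a5\<bar> \<le> k" "\<bar>a6\<bar> \<le> k"
      for a1 a2 a3 a4 a5 a6 k :: real
      using that unfolding abs_le_iff by linarith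
    have "\<bar>d\<bar> \<le> 6 * (e * ?n / 2)"
      unfolding d by (intro six b) simp_all
    then show ?thesis by simp
  qed
  have t2: "?t\<^sup>2 \<le> 3 * ?n"
  proof -
    have "?t\<^sup>2 \<le> 3 * ((?h 1 1)\<^sup>2 + (?h 2 2)\<^sup>2 + (?h 3 3)\<^sup>2)"
      unfolding t using sum_squares_bound[of "?h 1 1" "?h 2 2"]
        sum_squares_bound[of "?h 1 1" "?h 3 3"] sum_squares_bound[of "?h 2 2" "?h 3 3"]
      by (simp add: power2_eq_square algebra_simps)
    also have "\<dots> \<le> 3 * ?n" unfolding n by simp
    finally show ?thesis .
  qed
  \<comment> \<open>One factor of the squared trace is bounded by 5 |H|^2, where 5 = 3/2 + 1/2 + 3
    comes from the three terms of \<open>expand\<close>; the other factor is bounded by 3 e.\<close>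
  have "\<bar>?t\<bar> \<le> 5 * ?n"
  proof -
    have "3 * e * ?n \<le> 3 * ?n" using e by (intro mult_right_mono) auto
    then show ?thesis using expand ql dl t2 zero_le_power2[of ?t] by linarith
  qed
  moreover have "\<bar>?t\<bar> \<le> 3 * e" using ent[of 1 1] ent[of 2 2] ent[of 3 3] unfolding t by linarith
  ultimately have "\<bar>?t\<bar> * \<bar>?t\<bar> \<le> (3 * e) * (5 * ?n)" by (intro mult_mono) auto
  then have "?t\<^sup>2 \<le> 15 * e * ?n" by (simp add: power2_eq_square)
  then show ?thesis using that expand ql dl by blast
qed

text \<open>The expansion turns the linear term (mu - tau) tr H into a quadratic one. As |q| is at
  most |H|^2, the quadratic part is at least (mu - |c|)/2 |H|^2, and |c| < mu encodes both 0 < tau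
  and tau < 2 mu.\<close>

lemma isochoric_energy_gap:
  assumes tau: "0 < tau" "tau < 2 * mu"
  obtains e where "e > 0"
    "\<And>F. det F = 1 \<Longrightarrow> norm (F - mat 1) \<le> e \<Longrightarrow> F \<noteq> mat 1 \<Longrightarrow>
      - 3 * tau < strain_energy mu F - tau * trace F"
proof -
  define c where "c = tau - mu"
  have c: "\<bar>c\<bar> < mu" using tau by (auto simp: c_def)
  \<comment> \<open>The remainder is at most 11 e |c| |H|^2, since 15/2 + 3 is below 11. The factor
    44 keeps it below half of the quadratic gain.\<close>
  define e where "e = min 1 ((mu - \<bar>c\<bar>) / (44 * mu))"
  have e: "0 < e" "e \<le> 1" "44 * mu * e \<le> mu - \<bar>c\<bar>"
    using c tau by (auto simp: e_def min_def field_simps)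
  have "- 3 * tau < strain_energy mu F - tau * trace F"
    if F: "det F = 1" "norm (F - mat 1) \<le> e" "F \<noteq> mat 1" for F
  proof -
    define H where "H = F - mat 1"
    have FH: "F = mat 1 + H" by (simp add: H_def)
    let ?n = "(norm H)\<^sup>2" and ?t = "trace H"
    have n: "0 < ?n" using F(3) by (simp add: H_def)
    obtain q d where qd: "?t = - (?t\<^sup>2 / 2 - q / 2 + d)" "\<bar>q\<bar> \<le> ?n" "\<bar>d\<bar> \<le> 3 * e * ?n" "?t\<^sup>2 \<le> 15 * e * ?n"
      using isochoric_expansion[of H e] F e unfolding FH by auto
    have nF: "(norm F)\<^sup>2 = 3 + 2 * ?t + ?n"
      unfolding FH power2_norm_eq_inner
      by (simp add: inner_vec_def sum_3 mat_def trace_def algebra_simps)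
    have tF: "trace F = 3 + ?t" by (simp add: FH trace_def mat_def sum_3)
    have "strain_energy mu F - tau * trace F + 3 * tau = (mu - tau) * ?t + mu / 2 * ?n"
      by (simp add: strain_energy_eq nF tF algebra_simps)
    also have "\<dots> = c * (?t\<^sup>2 / 2 - q / 2 + d) + mu / 2 * ?n"
    proof -
      have "?t\<^sup>2 / 2 - q / 2 + d = - ?t" using qd(1) by linarith
      then show ?thesis by (simp only:) (simp add: c_def algebra_simps)
    qed
    also have "\<dots> \<ge> mu / 2 * ?n - \<bar>c\<bar> * (?n / 2 + 11 * e * ?n)"
    proof -
      have "\<bar>?t\<^sup>2 / 2 - q / 2 + d\<bar> \<le> ?n / 2 + 11 * e * ?n"
      proof -
        have "0 \<le> e * ?n" using e by simp
        moreover have "0 \<le> ?t\<^sup>2" by simp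
        ultimately show ?thesis using qd(2-4) by linarith
      qed
      then have "\<bar>c * (?t\<^sup>2 / 2 - q / 2 + d)\<bar> \<le> \<bar>c\<bar> * (?n / 2 + 11 * e * ?n)"
        unfolding abs_mult by (intro mult_left_mono) auto
      from abs_le_D2[OF this] show ?thesis by linarith
    qed
    moreover have "0 < mu / 2 * ?n - \<bar>c\<bar> * (?n / 2 + 11 * e * ?n)"
    proof -
      have "22 * \<bar>c\<bar> * e < 22 * mu * e" using c e by simp
      also have "\<dots> \<le> (mu - \<bar>c\<bar>) / 2" using e(3) by simp
      finally have "0 < mu / 2 - \<bar>c\<bar> * (1 / 2 + 11 * e)"
        using c e by (simp add: algebra_simps)
      then have "0 < (mu / 2 - \<bar>c\<bar> * (1 / 2 + 11 * e)) * ?n" using n by simp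
      then show ?thesis by (simp add: algebra_simps)
    qed
    ultimately show ?thesis by linarith
  qed
  then show ?thesis using that e by blast
qed

subsection \<open>Functions with almost everywhere vanishing derivative\<close>

text \<open>Fubini: for each fixed \<open>s\<close> the exceptional \<open>X\<close> form a
  translate of \<open>N\<close>, hence a null set; the two almost-everywhere quantifiers are then
  exchanged.\<close>

lemma AE_line_avoids_null_set:
  fixes v :: "'a::euclidean_space"
  assumes N: "N \<in> null_sets lborel"
  shows "AE X in lborel. AE s in lborel. X + s *\<^sub>R v \<notin> N"
proof -
  have [measurable]: "N \<in> sets borel" using N by (simp add: null_sets_def)
  have "AE s in lborel. AE X in lborel. X + s *\<^sub>R v \<notin> N"
  proof (rule AE_I2)
    fix s :: real
    have "AE X in distr lborel borel (\<lambda>X. s *\<^sub>R v + X). X \<notin> N"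
      using AE_not_in[OF N] using lborel_distr_plus[of "s *\<^sub>R v"] by metis
    then show "AE X in lborel. X + s *\<^sub>R v \<notin> N"
      by (subst (asm) AE_distr_iff) (auto simp: add.commute)
  qed
  moreover have "{p \<in> space (lborel \<Otimes>\<^sub>M lborel). fst p + snd p *\<^sub>R v \<notin> N} \<in> sets (lborel \<Otimes>\<^sub>M lborel)"
    by measurable
  ultimately show ?thesis by (subst lborel_pair.AE_commute) auto
qed

lemma AE_lborel_negligible:
  assumes "AE x in lborel. P (x::'a::euclidean_space)"
  shows "negligible {x. \<not> P x}"
  using assms unfolding negligible_iff_null_sets eventually_ae_filter
  by (auto simp: null_sets_completion_iff2)

text \<open>For almost every start \<open>Z\<close> the segment from \<open>Z\<close> to
  \<open>Z + v\<close> meets \<open>N\<close> in a set of length zero, so the derivative along it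
  integrates to 0. The fundamental theorem for \<open>has_integral\<close> asks for a derivative at
  every point of the segment, including those in \<open>N\<close>, but not for its
  continuity.\<close>

lemma constant_on_if_derivative_zero_AE:
  fixes f :: "'a::euclidean_space \<Rightarrow> 'b::euclidean_space"
  assumes D: "open D" "convex D" and N: "negligible N"
    and f: "\<And>X. X \<in> D \<Longrightarrow> f differentiable (at X)"
    and f0: "\<And>X. X \<in> D - N \<Longrightarrow> (f has_derivative (\<lambda>h. 0)) (at X)"
  shows "f constant_on D"
proof -
  \<comment> \<open>A Borel null superset, since the Fubini argument takes place in
    \<open>lborel\<close> and not in its completion.\<close>
  obtain N' where N': "N' \<in> null_sets lborel" "N \<subseteq> N'"
    using N by (auto simp: negligible_iff_null_sets null_sets_completion_iff2)
  have cont: "continuous_on D f"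
    using f by (meson continuous_at_imp_continuous_on differentiable_imp_continuous_within)
  have "f Y = f X" if XY: "X \<in> D" "Y \<in> D" for X Y
  proof -
    define v where "v = Y - X"
    define good where "good Z \<longleftrightarrow> (AE s in lborel. Z + s *\<^sub>R v \<notin> N')" for Z
    have "AE Z in lborel. good Z"
      unfolding good_def by (rule AE_line_avoids_null_set[OF N'(1)])
    then have bad: "negligible {Z. \<not> good Z}" by (rule AE_lborel_negligible)
    \<comment> \<open>The points whose translate by \<open>v\<close> stays in \<open>D\<close>;
      \<open>X\<close> is one of them because X + v = Y.\<close>
    define U where "U = D \<inter> (\<lambda>Z. Z + v) -` D"
    have U: "open U" unfolding U_def
      using D by (intro open_Int open_vimage) (auto intro!: continuous_intros)
    have const: "f (Z + v) = f Z" if Z: "Z \<in> U" "good Z" for Z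
    proof -
      have seg: "Z + s *\<^sub>R v \<in> D" if "s \<in> {0..1}" for s
        using convexD_alt[OF D(2), of Z "Z + v" s] Z that by (simp add: U_def algebra_simps)
      have vd: "((\<lambda>s. f (Z + s *\<^sub>R v)) has_vector_derivative frechet_derivative f (at (Z + s *\<^sub>R v)) v) (at s within {0..1})"
        if "s \<in> {0..1}" for s
      proof -
        let ?f' = "frechet_derivative f (at (Z + s *\<^sub>R v))"
        have d: "(f has_derivative ?f') (at (Z + s *\<^sub>R v))"
          using f[OF seg[OF that]] by (simp add: frechet_derivative_works)
        have "((\<lambda>s. Z + s *\<^sub>R v) has_derivative (\<lambda>h. h *\<^sub>R v)) (at s within {0..1})"
          by (auto intro!: derivative_eq_intros)
        from has_derivative_compose[OF this d]
        have "((\<lambda>s. f (Z + s *\<^sub>R v)) has_derivative (\<lambda>h. ?f' (h *\<^sub>R v))) (at s within {0..1})" .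
        then show ?thesis
          using linear_frechet_derivative[OF f[OF seg[OF that]]]
          by (simp add: has_vector_derivative_def linear_scale)
      qed
      have "((\<lambda>s. frechet_derivative f (at (Z + s *\<^sub>R v)) v) has_integral (f (Z + 1 *\<^sub>R v) - f (Z + 0 *\<^sub>R v))) {0..1}"
        by (rule fundamental_theorem_of_calculus) (use vd in auto)
      moreover have "((\<lambda>s. frechet_derivative f (at (Z + s *\<^sub>R v)) v) has_integral 0) {0..1}"
      proof (rule has_integral_spike[OF _ _ has_integral_0])
        show "negligible {s. \<not> Z + s *\<^sub>R v \<notin> N'}"
          using Z(2) unfolding good_def by (rule AE_lborel_negligible)
        show "frechet_derivative f (at (Z + s *\<^sub>R v)) v = 0"
          if "s \<in> {0..1} - {s. \<not> Z + s *\<^sub>R v \<notin> N'}" for s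
        proof -
          have "Z + s *\<^sub>R v \<in> D - N" using that seg N' by auto
          from frechet_derivative_at[OF f0[OF this]] show ?thesis by (metis)
        qed
      qed
      ultimately have "f (Z + 1 *\<^sub>R v) - f (Z + 0 *\<^sub>R v) = 0" by (rule has_integral_unique)
      then show ?thesis by simp
    qed
    \<comment> \<open>The exceptional set is open by continuity and null by \<open>const\<close>. An
      open null set is empty, so the identity holds at \<open>X\<close> itself and not merely almost
      everywhere.\<close>
    define V where "V = {Z \<in> U. f (Z + v) - f Z \<noteq> 0}"
    have "continuous_on U (\<lambda>Z. f (Z + v) - f Z)"
      using cont by (intro continuous_intros continuous_on_compose2[OF cont]) (auto simp: U_def elim: continuous_on_subset)
    then have "open V"
      using continuous_open_preimage[OF _ U, of "\<lambda>Z. f (Z + v) - f Z" "- {0}"]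
      by (simp add: V_def vimage_def Int_def open_Compl)
    moreover have "negligible V"
      using bad by (rule negligible_subset) (use const in \<open>auto simp: V_def\<close>)
    ultimately have "V = {}" using open_not_negligible by blast
    moreover have "X \<in> U" using XY by (simp add: U_def v_def)
    ultimately show ?thesis by (auto simp: V_def v_def)
  qed
  then show ?thesis unfolding constant_on_def by blast
qed

subsection \<open>Gradients and the body\<close>

lemma grad_works: "y differentiable (at X) \<Longrightarrow> (y has_derivative (\<lambda>h. grad y X *v h)) (at X)"
  by (simp add: jacobian_works)

lemma grad_eqI:
  assumes "(y has_derivative (\<lambda>h. A *v h)) (at X)"
  shows "grad y X = A"
  unfolding jacobian_def frechet_derivative_at[OF assms, symmetric]
  by (simp add: matrix_of_matrix_vector_mul)

lemma body_eq_box: "body = box 0 1"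
  by (auto simp: body_def mem_box_cart)

lemma open_body: "open body" and connected_body: "connected body"
  unfolding body_eq_box by (rule open_box, intro convex_connected convex_box)

lemma measure_body: "measure lebesgue body = 1"
proof -
  have "measure lebesgue body = measure lborel (cbox 0 (1 :: real^3))"
    by (simp add: body_eq_box measure_lborel_box_eq measure_lborel_cbox_eq)
  also have "\<dots> = 1" by (subst content_cbox_cart) (auto simp: interval_eq_empty_cart)
  finally show ?thesis .
qed

lemma body_lmeasurable: "body \<in> lmeasurable"
  by (simp add: body_eq_box)

subsection \<open>Stability of the reference state\<close>

text \<open>Only finitely many pieces are allowed, so continuity glues the local constants of
  \<open>y X - X\<close> together: a continuous function with finitely many values on a connected set is
  constant. (With infinitely many pieces a Cantor-type function would be a counterexample.)\<close>

lemma translation_if_grad_identity_AE: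
  assumes cont: "continuous_on body y" and pw: "piecewise_differentiable y"
    and N: "negligible {X \<in> diff_points y. grad y X \<noteq> mat 1}"
  obtains c where "\<And>X. X \<in> body \<Longrightarrow> y X = X + c"
proof -
  define f where "f X = y X - X" for X
  obtain P where P: "finite P" "\<And>D. D \<in> P \<Longrightarrow> open D" "\<And>D. D \<in> P \<Longrightarrow> connected D"
    "\<And>D. D \<in> P \<Longrightarrow> D \<subseteq> body" "\<And>D X. D \<in> P \<Longrightarrow> X \<in> D \<Longrightarrow> y differentiable (at X)"
    "negligible (body - \<Union>P)"
    using pw unfolding piecewise_differentiable_def by blast
  have piece: "f constant_on D" if D: "D \<in> P" for D
  proof (rule locally_constant_imp_constant)
    fix a assume a: "a \<in> D"
    \<comment> \<open>Balls supply the convexity that the pieces, being only connected, may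
      lack.\<close>
    obtain e where e: "e > 0" "ball a e \<subseteq> D" using P(2)[OF D] a openE by blast
    have "f constant_on ball a e"
    proof (rule constant_on_if_derivative_zero_AE[OF _ _ N])
      fix X assume "X \<in> ball a e"
      then have "y differentiable (at X)" using e P(5) D by blast
      then show "f differentiable (at X)" unfolding f_def by (intro differentiable_diff) auto
    next
      fix X assume X: "X \<in> ball a e - {X \<in> diff_points y. grad y X \<noteq> mat 1}"
      then have "y differentiable (at X)" "X \<in> body" using e P(4,5) D by blast+
      then have "grad y X = mat 1" using X by (auto simp: diff_points_def)
      then have "(y has_derivative (\<lambda>h. h)) (at X)"
        using grad_works[OF \<open>y differentiable (at X)\<close>] by simp
      then show "(f has_derivative (\<lambda>h. 0)) (at X)"
        unfolding f_def by (auto intro!: derivative_eq_intros)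
    qed auto
    then have "\<forall>X\<in>ball a e. f X = f a"
      using e centre_in_ball unfolding constant_on_def by metis
    moreover have "openin (top_of_set D) (ball a e)"
      using e openin_open_eq[OF P(2)[OF D]] by simp
    moreover have "a \<in> ball a e" using e by simp
    ultimately show "\<exists>T. openin (top_of_set D) T \<and> a \<in> T \<and> (\<forall>X\<in>T. f X = f a)" by blast
  qed (rule P(3)[OF D])
  then obtain c where c: "\<And>D X. D \<in> P \<Longrightarrow> X \<in> D \<Longrightarrow> f X = c D"
    unfolding constant_on_def by metis
  have contf: "continuous_on body f" unfolding f_def using cont by (intro continuous_intros)
  \<comment> \<open>This covers the interface points, which lie in no piece: the set where
    \<open>f\<close> leaves the finite value set is open and contained in the null set of
    interfaces.\<close>
  have vals: "f X \<in> c ` P" if X: "X \<in> body" for X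
  proof (rule ccontr)
    assume nX: "f X \<notin> c ` P"
    define V where "V = body \<inter> f -` (- (c ` P))"
    have "open V" unfolding V_def
      using P(1) by (intro continuous_open_preimage[OF contf open_body]) (auto intro: finite_imp_closed)
    moreover have "negligible V"
      using P(6) by (rule negligible_subset) (auto simp: V_def c)
    ultimately have "V = {}" using open_not_negligible by blast
    then show False using X nX by (auto simp: V_def)
  qed
  have "connected (f ` body)" using contf connected_body by (rule connected_continuous_image)
  moreover have "finite (f ` body)" using vals P(1) by (auto intro: finite_subset[of _ "c ` P"])
  ultimately have "f ` body = {} \<or> (\<exists>x. f ` body = {x})" by (simp add: connected_finite_iff_sing)
  then have "f constant_on body" unfolding constant_on_def by blast
  then obtain c where "\<And>X. X \<in> body \<Longrightarrow> f X = c" by (auto simp: constant_on_def)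
  then show ?thesis using that[of c] by (simp add: f_def algebra_simps)
qed

lemma energy_density_integral_const:
  assumes "\<And>X. X \<in> body \<Longrightarrow> strain_energy mu (grad y X) - tau * trace (grad y X) = k"
  shows "total_energy mu tau y = k"
proof -
  have "total_energy mu tau y = (\<integral>X\<in>body. k \<partial>lebesgue)"
    unfolding total_energy_def using body_lmeasurable
    by (intro set_lebesgue_integral_cong) (auto simp: assms fmeasurable_def)
  also have "\<dots> = k"
    using body_lmeasurable by (simp add: measure_body set_lebesgue_integral_def fmeasurable_def)
  finally show ?thesis .
qed

section \<open>Homogeneous triaxial stretches and the reference state\<close>

lemma triaxial_derivative:
  "(triaxial l has_derivative (\<lambda>h. (\<chi> i j. if i = j then l $ i else 0) *v h)) (at X)"
proof -
  have eq: "triaxial l = (\<lambda>h. (\<chi> i j. if i = j then l $ i else 0) *v h)"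
    by (simp add: fun_eq_iff triaxial_def matrix_vector_mult_def vec_eq_iff forall_3 sum_3)
  show ?thesis
    unfolding eq by (intro bounded_linear_imp_has_derivative matrix_vector_mul_bounded_linear)
qed

lemma grad_triaxial: "grad (triaxial l) X = (\<chi> i j. if i = j then l $ i else 0)"
  by (rule grad_eqI[OF triaxial_derivative])

lemma diff_points_triaxial: "diff_points (triaxial l) = body"
  using triaxial_derivative by (auto simp: diff_points_def differentiable_def)

lemma admissible_triaxial:
  assumes "l $ 1 * l $ 2 * l $ 3 = 1"
  shows "admissible (triaxial l)"
proof -
  have d: "triaxial l differentiable (at X)" for X
    using triaxial_derivative by (auto simp: differentiable_def)
  have "piecewise_differentiable (triaxial l)"
    unfolding piecewise_differentiable_def
    by (rule exI[of _ "{body}"]) (auto simp: open_body connected_body d)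
  moreover have "continuous_on body (triaxial l)"
    using d by (meson continuous_at_imp_continuous_on differentiable_imp_continuous_within)
  moreover have "det (grad (triaxial l) X) = 1" for X
    using assms by (simp add: grad_triaxial det_3)
  ultimately show ?thesis by (simp add: admissible_def)
qed

lemma total_energy_triaxial:
  "total_energy mu tau (triaxial l) =
     mu / 2 * ((l $ 1)\<^sup>2 + (l $ 2)\<^sup>2 + (l $ 3)\<^sup>2 - 3) - tau * (l $ 1 + l $ 2 + l $ 3)"
proof (rule energy_density_integral_const)
  fix X
  let ?F = "(\<chi> i j. if i = j then l $ i else 0) :: real^3^3"
  have "(norm ?F)\<^sup>2 = (l $ 1)\<^sup>2 + (l $ 2)\<^sup>2 + (l $ 3)\<^sup>2"
    unfolding norm_matrix_eq
    by (simp add: trace_def matrix_matrix_mult_def transpose_def sum_3 power2_eq_square)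
  moreover have "trace ?F = l $ 1 + l $ 2 + l $ 3" by (simp add: trace_def sum_3)
  ultimately show "strain_energy mu (grad (triaxial l) X) - tau * trace (grad (triaxial l) X) =
     mu / 2 * ((l $ 1)\<^sup>2 + (l $ 2)\<^sup>2 + (l $ 3)\<^sup>2 - 3) - tau * (l $ 1 + l $ 2 + l $ 3)"
    by (simp add: strain_energy_eq grad_triaxial)
qed

lemma grad_reference: "grad (triaxial reference) X = mat 1"
  by (simp add: grad_triaxial reference_def mat_def vec_eq_iff)

lemma admissible_reference: "admissible (triaxial reference)"
  by (rule admissible_triaxial) (simp add: reference_def)

lemma total_energy_reference: "total_energy mu tau (triaxial reference) = - 3 * tau"
  by (simp add: total_energy_triaxial reference_def)

text \<open>If the energy density of a competitor is not integrable, its \<open>total_energy\<close> is the junk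
  value \<open>0\<close>, which still exceeds the energy \<open>- 3 * tau\<close> of the reference state.\<close>

lemma reference_stable:
  assumes tau: "0 < tau" "tau < 2 * mu"
  shows "stable_deformation mu tau (triaxial reference)"
proof -
  obtain e where e: "e > 0"
    "\<And>F. det F = 1 \<Longrightarrow> norm (F - mat 1) \<le> e \<Longrightarrow> F \<noteq> mat 1 \<Longrightarrow>
      - 3 * tau < strain_energy mu F - tau * trace F"
    by (rule isochoric_energy_gap[OF tau]) blast
  have "- 3 * tau < total_energy mu tau y" if y: "y \<in> competitors (triaxial reference) e" for y
  proof (rule ccontr)
    assume less: "\<not> - 3 * tau < total_energy mu tau y"
    define w where "w X = strain_energy mu (grad y X) - tau * trace (grad y X)" for X
    have adm: "admissible y" and near: "\<And>X. X \<in> diff_points y \<Longrightarrow> norm (grad y X - mat 1) \<le> e"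
      and ex: "\<exists>X\<in>diff_points y. grad y X \<noteq> mat 1"
      using y unfolding competitors_def diff_points_triaxial grad_reference
      by (auto simp: diff_points_def)
    have pw: "piecewise_differentiable y" and cont: "continuous_on body y"
      and det: "\<And>X. X \<in> diff_points y \<Longrightarrow> det (grad y X) = 1"
      using adm by (auto simp: admissible_def)
    have at_identity: "w X = - 3 * tau" if "grad y X = mat 1" for X
    proof -
      have "norm (mat 1 :: real^3^3) ^ 2 = 3"
        unfolding power2_norm_eq_inner by (simp add: inner_vec_def sum_3 mat_def)
      then show ?thesis by (simp add: w_def that strain_energy_eq trace_I)
    qed
    have gap: "- 3 * tau < w X" if "X \<in> diff_points y" "grad y X \<noteq> mat 1" for X
      unfolding w_def using e(2) det near that by blast
    have null: "negligible (body - diff_points y)"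
    proof -
      obtain P where "negligible (body - \<Union>P)" "\<And>D X. D \<in> P \<Longrightarrow> X \<in> D \<Longrightarrow> X \<in> diff_points y"
        using pw unfolding piecewise_differentiable_def diff_points_def by blast
      then show ?thesis by (auto elim!: negligible_subset)
    qed
    \<comment> \<open>The excess over the reference density, cut off outside the body. As the body
      has volume 1, its integral is exactly the energy difference.\<close>
    define g where "g X = indicator body X *\<^sub>R (w X + 3 * tau)" for X
    have int_w: "set_integrable lebesgue body w"
    proof (rule ccontr)
      assume "\<not> set_integrable lebesgue body w"
      then have "total_energy mu tau y = 0"
        unfolding total_energy_def w_def[symmetric] set_integrable_def set_lebesgue_integral_def
        by (rule not_integrable_integral_eq)
      then show False using less tau by simp
    qed
    have int_c: "set_integrable lebesgue body (\<lambda>X. 3 * tau)"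
      using body_lmeasurable by (auto simp: set_integrable_def fmeasurable_def intro!: integrable_real_indicator)
    have "integrable lebesgue g" and "(LINT X|lebesgue. g X) = total_energy mu tau y + 3 * tau"
    proof -
      have "(\<integral>X\<in>body. 3 * tau \<partial>lebesgue) = 3 * tau"
        using body_lmeasurable by (simp add: measure_body set_lebesgue_integral_def fmeasurable_def)
      then show "(LINT X|lebesgue. g X) = total_energy mu tau y + 3 * tau"
        using set_integral_add(2)[OF int_w int_c] unfolding g_def set_lebesgue_integral_def total_energy_def w_def by simp
      show "integrable lebesgue g"
        using set_integral_add(1)[OF int_w int_c] unfolding g_def set_integrable_def .
    qed
    moreover have nonneg: "AE X in lebesgue. 0 \<le> g X"
    proof (rule AE_I')
      show "body - diff_points y \<in> null_sets lebesgue" using null by (simp add: negligible_iff_null_sets)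
      have "0 \<le> w X + 3 * tau" if "X \<in> diff_points y" for X
        using gap[OF that] at_identity[of X] by (cases "grad y X = mat 1") auto
      then show "{X \<in> space lebesgue. \<not> 0 \<le> g X} \<subseteq> body - diff_points y"
        by (auto simp: g_def indicator_def split: if_splits)
    qed
    moreover have "0 \<le> (LINT X|lebesgue. g X)" using nonneg by (rule integral_nonneg_AE)
    ultimately have "AE X in lebesgue. g X = 0"
      using less integral_nonneg_eq_0_iff_AE[of lebesgue g] by auto
    then obtain N where N: "N \<in> null_sets lebesgue" "\<And>X. X \<notin> N \<Longrightarrow> g X = 0"
      by (auto elim!: AE_E3)
    have "negligible {X \<in> diff_points y. grad y X \<noteq> mat 1}"
    proof (rule negligible_subset)
      show "negligible N" using N by (simp add: negligible_iff_null_sets)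
      show "{X \<in> diff_points y. grad y X \<noteq> mat 1} \<subseteq> N"
      proof clarify
        fix X assume X: "X \<in> diff_points y" "grad y X \<noteq> mat 1"
        then have "g X \<noteq> 0" using gap[OF X] by (auto simp: g_def diff_points_def)
        then show "X \<in> N" using N by blast
      qed
    qed
    \<comment> \<open>\<open>ex\<close> provides only one point with a different gradient, and a
      null set could contain it; the translation form fixes the gradient at every point of the
      body.\<close>
    then obtain c where c: "\<And>X. X \<in> body \<Longrightarrow> y X = X + c"
      using translation_if_grad_identity_AE[OF cont pw] by blast
    have "grad y X = mat 1" if "X \<in> body" for X
    proof (rule grad_eqI)
      have "((\<lambda>X. X + c) has_derivative (\<lambda>h. h)) (at X)" by (auto intro!: derivative_eq_intros)
      then have "(y has_derivative (\<lambda>h. h)) (at X)"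
        by (rule has_derivative_transform_within_open[OF _ open_body that]) (simp add: c)
      then show "(y has_derivative (\<lambda>h. mat 1 *v h)) (at X)" by simp
    qed
    then show False using ex by (auto simp: diff_points_def)
  qed
  then show ?thesis
    unfolding stable_deformation_def total_energy_reference
    using admissible_reference e(1) by blast
qed

text \<open>The plane strains \<open>diag(a, 1/a, 1)\<close> have energy density
  \<open>(c - 2) * (mu / 2 * (c + 2) - tau) - 3 * tau\<close> with \<open>c = a + 1/a > 2\<close>.\<close>

lemma reference_unstable:
  assumes mu: "0 < mu" "2 * mu < tau"
  shows "unstable_deformation mu tau (triaxial reference)"
proof -
  have "\<exists>y\<in>competitors (triaxial reference) e. total_energy mu tau y < total_energy mu tau (triaxial reference)"
    if e: "e > 0" for e
  proof -
    let ?l = "\<lambda>a::real. vector [a, 1 / a, 1] :: real^3"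
    \<comment> \<open>The limit is 2 mu, so \<open>2 * mu < tau\<close> leaves room for all
      \<open>a\<close> slightly above 1.\<close>
    have "((\<lambda>a::real. mu / 2 * (a + 1 / a + 2)) \<longlongrightarrow> mu / 2 * (1 + 1 / 1 + 2)) (at_right 1)"
      by (intro tendsto_intros) auto
    then have "eventually (\<lambda>a. mu / 2 * (a + 1 / a + 2) < tau) (at_right 1)"
      by (rule order_tendstoD) (use mu in simp)
    moreover have "((\<lambda>a::real. \<bar>a - 1\<bar> + \<bar>1 / a - 1\<bar>) \<longlongrightarrow> \<bar>1 - 1\<bar> + \<bar>1 / 1 - 1\<bar>) (at_right 1)"
      by (intro tendsto_intros) auto
    then have "eventually (\<lambda>a. \<bar>a - 1\<bar> + \<bar>1 / a - 1\<bar> < e) (at_right 1)"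
      by (rule order_tendstoD) (use e in simp)
    moreover have "eventually (\<lambda>a. a > (1::real)) (at_right 1)"
      by (rule eventually_at_right_less)
    ultimately have "eventually (\<lambda>a. mu / 2 * (a + 1 / a + 2) < tau \<and> \<bar>a - 1\<bar> + \<bar>1 / a - 1\<bar> < e \<and> a > 1) (at_right 1)"
      by eventually_elim auto
    then obtain a where a: "mu / 2 * (a + 1 / a + 2) < tau" "\<bar>a - 1\<bar> + \<bar>1 / a - 1\<bar> < e" "a > 1"
      using eventually_happens'[OF trivial_limit_at_right_real] by blast
    define c where "c = a + 1 / a"
    have "c - 2 = (a - 1)\<^sup>2 / a" using a(3) by (simp add: c_def field_simps power2_eq_square)
    then have c: "c > 2" using a(3) by (smt (verit) divide_pos_pos zero_less_power2)
    have G: "grad (triaxial (?l a)) X - mat 1 = (\<chi> i j. if i = j then (vector [a - 1, 1 / a - 1, 0] :: real^3) $ i else 0)" for X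
      by (simp add: grad_triaxial vec_eq_iff mat_def forall_3 vector_3)
    have "norm (grad (triaxial (?l a)) X - mat 1) \<le> e" for X
    proof -
      have "norm (grad (triaxial (?l a)) X - mat 1) = sqrt ((a - 1)\<^sup>2 + (1 / a - 1)\<^sup>2)"
        unfolding G by (simp add: norm_eq_sqrt_inner inner_vec_def sum_3 vector_3 power2_eq_square)
      also have "\<dots> \<le> \<bar>a - 1\<bar> + \<bar>1 / a - 1\<bar>"
        by (rule sqrt_sum_squares_le_sum_abs)
      finally show ?thesis using a(2) by simp
    qed
    moreover have "\<exists>X\<in>body. grad (triaxial (?l a)) X \<noteq> mat 1"
    proof
      show "(\<chi> i. 1 / 2) \<in> body" by (simp add: body_def)
      show "grad (triaxial (?l a)) (\<chi> i. 1 / 2) \<noteq> mat 1"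
        using a(3) by (simp add: grad_triaxial vec_eq_iff mat_def forall_3 vector_3)
    qed
    ultimately have "triaxial (?l a) \<in> competitors (triaxial reference) e"
      using a(3) by (simp add: competitors_def diff_points_triaxial grad_reference admissible_triaxial vector_3)
    moreover have "total_energy mu tau (triaxial (?l a)) = (c - 2) * (mu / 2 * (c + 2) - tau) - 3 * tau"
      using a(3) by (simp add: total_energy_triaxial vector_3 c_def field_simps power2_eq_square)
    moreover have "(c - 2) * (mu / 2 * (c + 2) - tau) < 0"
      using c a(1) by (intro mult_pos_neg) (auto simp: c_def)
    ultimately show ?thesis by (intro bexI[of _ "triaxial (?l a)"]) (simp_all add: total_energy_reference)
  qed
  then show ?thesis
    unfolding unstable_deformation_def using admissible_reference by (meson not_le)
qed

subsection \<open>Counting the equilibria\<close>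

text \<open>\<open>m\<close> is the critical point of s^2 + 1/s, where 2 s = 1/s^2, that is s^3 =
  1/2. Hence 1/m = 2 m^2 and the minimum is 3 m^2; these facts keep the later arguments polynomial
  in \<open>m\<close>.\<close>

lemma cubert_half:
  defines "m \<equiv> 2 powr (- 1 / 3) :: real"
  shows "0 < m" "m ^ 3 = 1 / 2" "3 / 2 powr (2 / 3) = 3 * m\<^sup>2"
proof -
  show m: "0 < m" by (simp add: m_def)
  have "m ^ 3 = m powr 3" using m by simp
  also have "\<dots> = 2 powr - 1" unfolding m_def powr_powr by simp
  finally show "m ^ 3 = 1 / 2" by (simp add: powr_minus_divide)
  have "m\<^sup>2 = m powr 2" using m by simp
  also have "\<dots> = 2 powr - (2 / 3)" unfolding m_def powr_powr by simp
  finally show "3 / 2 powr (2 / 3) = 3 * m\<^sup>2" by (simp add: powr_minus_divide)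
qed

lemma load_curve_lower_bound:
  fixes x :: real
  assumes "0 < x"
  shows "3 / 2 powr (2 / 3) \<le> x + 1 / sqrt x"
proof -
  define m :: real where "m = 2 powr (- 1 / 3)"
  note m = cubert_half[folded m_def]
  define s where "s = sqrt x"
  have s: "0 < s" "x = s\<^sup>2" using assms by (simp_all add: s_def)
  \<comment> \<open>With 1 written as 2 m^3 the numerator becomes a cubic that has a double root at
    the minimiser.\<close>
  have "s\<^sup>2 + 1 / s - 3 * m\<^sup>2 = (s ^ 3 - 3 * m\<^sup>2 * s + 2 * m ^ 3) / s"
    using s m by (simp add: field_simps power2_eq_square power3_eq_cube)
  also have "\<dots> = (s - m)\<^sup>2 * (s + 2 * m) / s"
    by (simp add: algebra_simps power2_eq_square power3_eq_cube)
  also have "\<dots> \<ge> 0" using s m by simp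
  finally show ?thesis using s m(3) by (simp add: s_def[symmetric])
qed

lemma load_curve_two_preimages:
  fixes k :: real
  assumes k: "3 / 2 powr (2 / 3) < k"
  shows "card {x. 0 < x \<and> x + 1 / sqrt x = k} = 2"
proof -
  define m :: real where "m = 2 powr (- 1 / 3)"
  note m = cubert_half[folded m_def]
  define h :: "real \<Rightarrow> real" where "h s = s\<^sup>2 + 1 / s" for s
  have hm: "h m = 3 * m\<^sup>2"
    using m(1,2) by (simp add: h_def field_simps power2_eq_square power3_eq_cube)
  have k': "3 * m\<^sup>2 < k" using k m(3) by simp
  then have k0: "0 < k" using m(1) by (smt (verit) zero_less_power)
  \<comment> \<open>For s < t the sign of the increment is that of s t (s + t) - 1, and s t (s + t)
    equals 2 m^3 = 1 at s = t = m. This gives monotonicity on both sides of \<open>m\<close> without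
    derivatives.\<close>
  have diff: "h t - h s = (t - s) * (s * t * (s + t) - 1) / (s * t)" if "0 < s" "0 < t" for s t
    using that by (simp add: h_def field_simps power2_eq_square)
  have dec: "h t < h s" if "0 < s" "s < t" "t \<le> m" for s t
  proof -
    have "s * t * (s + t) < m * m * (m + m)"
      using that mult_less_le_imp_less[of s m t m] by (intro mult_strict_mono[of "s * t"]) auto
    then have "s * t * (s + t) - 1 < 0" using m(2) by (simp add: power3_eq_cube)
    then have "(t - s) * (s * t * (s + t) - 1) / (s * t) < 0"
      using that by (intro divide_neg_pos mult_pos_neg) auto
    then show ?thesis using diff[of s t] that by simp
  qed
  have inc: "h s < h t" if "m \<le> s" "s < t" for s t
  proof -
    have "m * m * (m + m) < s * t * (s + t)"
      using that m(1) mult_le_less_imp_less[of m s m t] by (intro mult_strict_mono[of "m * m"]) auto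
    then have "0 < s * t * (s + t) - 1" using m(2) by (simp add: power3_eq_cube)
    then have "0 < (t - s) * (s * t * (s + t) - 1) / (s * t)"
      using that m(1) by (intro divide_pos_pos mult_pos_pos) auto
    then show ?thesis using diff[of s t] that m(1) by simp
  qed
  have cont: "continuous_on {a..b} h" if "0 < a" for a b
    unfolding h_def using that by (intro continuous_intros) auto
  \<comment> \<open>The outer endpoints 1/k and sqrt k are chosen so that one summand of
    \<open>h\<close> alone already equals \<open>k\<close>.\<close>
  have "1 / k < m"
  proof -
    have "1 < k * m"
    proof -
      have "3 * m\<^sup>2 * m < k * m" using k' m(1) by simp
      then show ?thesis using m(2) by (simp add: power2_eq_square power3_eq_cube)
    qed
    then show ?thesis using k0 by (simp add: field_simps)
  qed
  moreover have "k \<le> h (1 / k)" using k0 by (simp add: h_def)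
  ultimately obtain s1 where s1: "1 / k \<le> s1" "s1 \<le> m" "h s1 = k"
    using IVT2'[of h m k "1 / k"] cont[of "1 / k" m] hm k' k0 by auto
  have "m < sqrt k"
    using k' m(1) by (intro real_less_rsqrt) (smt (verit) zero_le_power2)
  moreover have "k \<le> h (sqrt k)" using k0 by (simp add: h_def)
  ultimately obtain s2 where s2: "m \<le> s2" "h s2 = k"
    using IVT'[of h m k "sqrt k"] cont[of m "sqrt k"] hm k' m(1) by auto
  have s10: "0 < s1" using s1(1) k0 by (smt (verit) zero_less_divide_1_iff)
  have "s1 \<noteq> m" "s2 \<noteq> m" using s1 s2 hm k' by auto
  then have s12: "s1 < s2" using s1(2) s2(1) by simp
  have "{x. 0 < x \<and> x + 1 / sqrt x = k} = {s1\<^sup>2, s2\<^sup>2}"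
  proof (intro equalityI subsetI)
    fix x assume "x \<in> {x. 0 < x \<and> x + 1 / sqrt x = k}"
    then have s: "0 < sqrt x" "x = (sqrt x)\<^sup>2" "h (sqrt x) = k" by (auto simp: h_def)
    have "sqrt x = s1 \<or> sqrt x = s2"
    proof (cases "sqrt x \<le> m")
      case True
      then show ?thesis using dec[of s1 "sqrt x"] dec[of "sqrt x" s1] s s1 s10 by force
    next
      case False
      then show ?thesis using inc[of s2 "sqrt x"] inc[of "sqrt x" s2] s s2 by force
    qed
    then show "x \<in> {s1\<^sup>2, s2\<^sup>2}" using s(2) by auto
  next
    fix x assume "x \<in> {s1\<^sup>2, s2\<^sup>2}"
    then show "x \<in> {x. 0 < x \<and> x + 1 / sqrt x = k}"
      using s1 s2 s10 s12 by (auto simp: h_def)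
  qed
  moreover have "s1\<^sup>2 \<noteq> s2\<^sup>2" using s10 s12 by (simp add: power2_eq_iff)
  ultimately show ?thesis by simp
qed

lemma solutions_eq:
  assumes "0 < mu"
  shows "solutions mu tau = {x. 0 < x \<and> x + 1 / sqrt x = tau / mu} - {1}"
  using assms by (auto simp: solutions_def field_simps)

lemma solutions_empty:
  assumes "0 < mu" "tau < 3 * mu / 2 powr (2 / 3)"
  shows "solutions mu tau = {}"
proof -
  have "tau / mu < 3 / 2 powr (2 / 3)" using assms by (simp add: field_simps)
  then show ?thesis
    using load_curve_lower_bound unfolding solutions_eq[OF assms(1)] by fastforce
qed

lemma card_solutions:
  assumes "0 < mu" "3 * mu / 2 powr (2 / 3) < tau" "tau \<noteq> 2 * mu"
  shows "card (solutions mu tau) = 2"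
proof -
  have "3 / 2 powr (2 / 3) < tau / mu" using assms by (simp add: field_simps)
  \<comment> \<open>The trivial stretch lies on the load curve exactly when tau = 2 mu; otherwise
    removing 1 leaves both preimages.\<close>
  moreover have "1 \<notin> {x. 0 < x \<and> x + 1 / sqrt x = tau / mu}"
    using assms by (simp add: field_simps)
  ultimately show ?thesis
    using load_curve_two_preimages unfolding solutions_eq[OF assms(1)] by simp
qed

section \<open>Equilibria up to permutation of the axes\<close>

lemma equiv_axis_permutation: "equiv UNIV axis_permutation"
proof (rule equivI)
  show "refl axis_permutation"
    by (auto simp: refl_on_def axis_permutation_def vec_eq_iff intro!: exI[of _ id] permutes_id)
  show "sym axis_permutation"
  proof (rule symI)
    fix l m assume "(l, m) \<in> axis_permutation"
    then obtain p where p: "p permutes UNIV" "m = (\<chi> i. l $ p i)" by (auto simp: axis_permutation_def)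
    then have "l = (\<chi> i. m $ inv p i)" by (simp add: permutes_inverses vec_eq_iff)
    then show "(m, l) \<in> axis_permutation"
      using permutes_inv[OF p(1)] by (auto simp: axis_permutation_def)
  qed
  show "trans axis_permutation"
  proof (rule transI)
    fix l m n assume "(l, m) \<in> axis_permutation" "(m, n) \<in> axis_permutation"
    then obtain p q where "p permutes UNIV" "m = (\<chi> i. l $ p i)" "q permutes UNIV" "n = (\<chi> i. m $ q i)"
      by (auto simp: axis_permutation_def)
    then show "(l, n) \<in> axis_permutation"
      by (auto simp: axis_permutation_def intro!: exI[of _ "p \<circ> q"] permutes_compose)
  qed
qed auto

lemma class_reference: "axis_permutation `` {reference} = {reference}"
  by (auto simp: axis_permutation_def reference_def intro!: exI[of _ id] permutes_id)

lemma reference_equilibrium: "reference \<in> equilibria mu tau"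
  by (auto simp: equilibria_def reference_def prod_UNIV_3 intro!: exI[of _ "mu - tau"])

lemma uniaxial_components:
  assumes "0 < x"
  shows "uniaxial x $ 1 = x" "uniaxial x $ 2 = 1 / sqrt x" "uniaxial x $ 3 = 1 / sqrt x"
  using assms by (simp_all add: uniaxial_def vector_3 powr_minus_divide powr_half_sqrt)

lemma uniaxial_nontrivial_equilibrium:
  assumes x: "x \<in> solutions mu tau"
  shows "uniaxial x \<in> equilibria mu tau - {reference}"
proof -
  define a where "a = 1 / sqrt x"
  have x0: "0 < x" "x \<noteq> 1" "tau = mu * (x + a)" using x by (auto simp: solutions_def a_def)
  have a: "0 < a" "x * a * a = 1" using x0 by (simp_all add: a_def)
  note u = uniaxial_components[OF x0(1), folded a_def]
  have "uniaxial x \<noteq> reference" using u(1) x0(2) by (auto simp: reference_def)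
  \<comment> \<open>The pressure comes from Vieta: x and a are to be the roots of mu z^2 - tau z -
    p, so their product is -p/mu.\<close>
  moreover have "\<forall>i. - (- mu * a * x) / uniaxial x $ i + mu * uniaxial x $ i = tau"
    using a x0 by (simp add: forall_3 u field_simps)
  then have "\<exists>p. \<forall>i. - p / uniaxial x $ i + mu * uniaxial x $ i = tau" by blast
  moreover have "(\<forall>i. 0 < uniaxial x $ i) \<and> (\<Prod>i\<in>UNIV. uniaxial x $ i) = 1"
    using a x0 by (simp add: forall_3 u prod_UNIV_3)
  ultimately show ?thesis unfolding equilibria_def by blast
qed

text \<open>Let x be the stretch along the odd axis \<open>j\<close> and a the common value of the
  other two. Vieta for the sum gives the load equation mu (x + a) = tau, incompressibility gives a =
  1/sqrt x, and exchanging the axes 1 and \<open>j\<close> produces the normal form.\<close>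

lemma nontrivial_equilibrium_uniaxial:
  assumes mu: "0 < mu" and l: "l \<in> equilibria mu tau - {reference}"
  obtains x where "x \<in> solutions mu tau" "(uniaxial x, l) \<in> axis_permutation"
proof -
  have pos: "0 < l $ i" for i using l by (simp add: equilibria_def)
  have prod: "l $ 1 * l $ 2 * l $ 3 = 1" using l by (simp add: equilibria_def prod_UNIV_3)
  obtain p where p': "- p / l $ i + mu * l $ i = tau" for i using l by (auto simp: equilibria_def)
  have p: "mu * (l $ i)\<^sup>2 - tau * l $ i = p" for i
  proof -
    have "p / l $ i = mu * l $ i - tau" using p'[of i] by simp
    moreover have "p = p / l $ i * l $ i" using pos[of i] by simp
    ultimately have "p = (mu * l $ i - tau) * l $ i" by (simp only:)
    then show ?thesis by (simp add: algebra_simps power2_eq_square)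
  qed
  have "(l $ i - l $ j) * (mu * (l $ i + l $ j) - tau) = 0" for i j
    using p[of i] p[of j] by (simp add: algebra_simps power2_eq_square)
  then have two: "l $ i = l $ j \<or> mu * (l $ i + l $ j) = tau" for i j by simp
  have "\<not> (l $ 1 = l $ 2 \<and> l $ 1 = l $ 3)"
  proof
    assume e: "l $ 1 = l $ 2 \<and> l $ 1 = l $ 3"
    then have "(l $ 1) ^ 3 = 1" using prod by (metis power3_eq_cube)
    then have "l $ 1 = 1" using pos[of 1] power_eq_imp_eq_base[of "l $ 1" 3 1] by simp
    then have "l = reference" using e by (simp add: reference_def vec_eq_iff forall_3)
    then show False using l by simp
  qed
  moreover have "l $ 2 = l $ 3" if "l $ 1 \<noteq> l $ 2" "l $ 1 \<noteq> l $ 3"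
  proof -
    have "mu * (l $ 1 + l $ 2) = mu * (l $ 1 + l $ 3)" using two[of 1 2] two[of 1 3] that by simp
    then show ?thesis using mu by simp
  qed
  ultimately consider "l $ 1 = l $ 2" "l $ 3 \<noteq> l $ 1" | "l $ 1 = l $ 3" "l $ 2 \<noteq> l $ 1"
    | "l $ 2 = l $ 3" "l $ 1 \<noteq> l $ 2"
    by metis
  then have "\<exists>j a. (\<forall>i. i \<noteq> j \<longrightarrow> l $ i = a) \<and> l $ j \<noteq> a"
  proof cases
    case 1
    then show ?thesis by (intro exI[of _ 3] exI[of _ "l $ 1"]) (simp add: forall_3)
  next
    case 2
    then show ?thesis by (intro exI[of _ 2] exI[of _ "l $ 1"]) (simp add: forall_3)
  next
    case 3
    then show ?thesis by (intro exI[of _ 1] exI[of _ "l $ 2"]) (simp add: forall_3)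
  qed
  then obtain j a where ja: "\<And>i. i \<noteq> j \<Longrightarrow> l $ i = a" "l $ j \<noteq> a" by blast
  define x where "x = l $ j"
  obtain i where i: "i \<noteq> j"
  proof -
    have "(1 :: 3) \<noteq> 2" by simp
    then show thesis using that by metis
  qed
  have sum: "mu * (x + a) = tau" using two[of j i] ja i by (auto simp: x_def)
  have xaa: "x * a * a = 1"
    using prod ja(1)[of 1] ja(1)[of 2] ja(1)[of 3] exhaust_3[of j] x_def
    by (elim disjE) (simp_all add: mult_ac)
  have pos': "0 < x" "0 < a" using pos ja i by (auto simp: x_def)
  have "(sqrt x * a)\<^sup>2 = x * a\<^sup>2" using pos' by (simp add: power_mult_distrib)
  also have "\<dots> = 1" using xaa by (simp add: power2_eq_square mult.assoc)
  finally have "(sqrt x * a)\<^sup>2 = 1" .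
  then have "sqrt x * a = 1" using pos' power2_eq_imp_eq[of "sqrt x * a" 1] by simp
  then have a: "a = 1 / sqrt x" using pos' by (simp add: field_simps)
  have "x \<noteq> 1" using a ja by (auto simp: x_def)
  then have "x \<in> solutions mu tau" using sum pos' a by (simp add: solutions_def)
  moreover have "l = (\<chi> i. uniaxial x $ Transposition.transpose 1 j i)"
  proof -
    have "uniaxial x $ Transposition.transpose 1 j i = l $ i" for i
      using ja(1)[of 1] ja(1)[of 2] ja(1)[of 3] exhaust_3[of j] exhaust_3[of i] x_def
        uniaxial_components[OF pos'(1), folded a]
      by (elim disjE) (simp_all add: Transposition.transpose_def)
    then show ?thesis by (simp add: vec_eq_iff)
  qed
  then have "(uniaxial x, l) \<in> axis_permutation"
    unfolding axis_permutation_def by (auto intro!: exI[of _ "Transposition.transpose 1 j"] permutes_swap_id)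
  ultimately show ?thesis by (rule that)
qed

lemma nontrivial_classes:
  assumes "0 < mu"
  shows "(equilibria mu tau - {reference}) // axis_permutation =
    (\<lambda>x. axis_permutation `` {uniaxial x}) ` solutions mu tau"
proof (intro equalityI subsetI)
  fix c assume "c \<in> (equilibria mu tau - {reference}) // axis_permutation"
  then obtain l where l: "l \<in> equilibria mu tau - {reference}" "c = axis_permutation `` {l}"
    by (auto elim!: quotientE)
  then obtain x where "x \<in> solutions mu tau" "(uniaxial x, l) \<in> axis_permutation"
    using nontrivial_equilibrium_uniaxial[OF assms] by blast
  then show "c \<in> (\<lambda>x. axis_permutation `` {uniaxial x}) ` solutions mu tau"
    using equiv_class_eq[OF equiv_axis_permutation] l(2) by blast
next
  fix c assume "c \<in> (\<lambda>x. axis_permutation `` {uniaxial x}) ` solutions mu tau"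
  then show "c \<in> (equilibria mu tau - {reference}) // axis_permutation"
    using uniaxial_nontrivial_equilibrium by (auto intro: quotientI)
qed

text \<open>The trace is invariant under permutations of the axes; on \<open>(\<lambda>, \<lambda>\<^sup>-\<^sup>1\<^sup>/\<^sup>2, \<lambda>\<^sup>-\<^sup>1\<^sup>/\<^sup>2)\<close> it equals
  \<open>2 * tau / mu - \<lambda>\<close>, which recovers \<open>\<lambda>\<close>.\<close>

lemma inj_on_uniaxial_class:
  assumes "0 < mu"
  shows "inj_on (\<lambda>x. axis_permutation `` {uniaxial x}) (solutions mu tau)"
proof (rule inj_onI)
  fix x y assume x: "x \<in> solutions mu tau" and y: "y \<in> solutions mu tau"
    and "axis_permutation `` {uniaxial x} = axis_permutation `` {uniaxial y}"
  then have "(uniaxial x, uniaxial y) \<in> axis_permutation"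
    using eq_equiv_class[OF _ equiv_axis_permutation] by blast
  then obtain p where p: "p permutes UNIV" "uniaxial y = (\<chi> i. uniaxial x $ p i)"
    by (auto simp: axis_permutation_def)
  have "(\<Sum>i\<in>UNIV. uniaxial x $ i) = (\<Sum>i\<in>UNIV. uniaxial x $ p i)"
    using sum.permute[OF p(1)] by (simp add: o_def)
  also have "\<dots> = (\<Sum>i\<in>UNIV. uniaxial y $ i)" by (simp add: p(2))
  finally have "x + 2 / sqrt x = y + 2 / sqrt y"
    using x y by (simp add: sum_3 uniaxial_components solutions_def)
  moreover have "mu * (x + 1 / sqrt x) = mu * (y + 1 / sqrt y)" using x y by (auto simp: solutions_def)
  then have "x + 1 / sqrt x = y + 1 / sqrt y" using assms by simp
  ultimately show "x = y" by simp
qed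

lemma card_nontrivial_classes:
  assumes "0 < mu"
  shows "card ((equilibria mu tau - {reference}) // axis_permutation) = card (solutions mu tau)"
  unfolding nontrivial_classes[OF assms] by (rule card_image[OF inj_on_uniaxial_class[OF assms]])

lemma num_possible_unstable:
  assumes "0 < mu" "\<not> stable_deformation mu tau (triaxial reference)"
  shows "num_possible_equilibria mu tau = card (solutions mu tau)"
proof -
  have "possible_equilibria mu tau = equilibria mu tau - {reference}"
    using assms by (auto simp: possible_equilibria_def)
  then show ?thesis by (simp add: num_possible_equilibria_def card_nontrivial_classes assms)
qed

text \<open>The reference stretch is fixed by all permutations, so its class is a singleton and adds
  exactly one. Finiteness guards against \<open>card\<close> being 0 on infinite sets.\<close>

lemma num_possible_stable:
  assumes "0 < mu" "stable_deformation mu tau (triaxial reference)" "finite (solutions mu tau)"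
  shows "num_possible_equilibria mu tau = Suc (card (solutions mu tau))"
proof -
  let ?Q = "(equilibria mu tau - {reference}) // axis_permutation"
  have "possible_equilibria mu tau = insert reference (equilibria mu tau - {reference})"
    using assms(2) reference_equilibrium by (auto simp: possible_equilibria_def)
  then have "possible_equilibria mu tau // axis_permutation = insert {reference} ?Q"
    unfolding quotient_def by (auto simp only: class_reference UN_insert)
  moreover have "{reference} \<notin> ?Q"
    using equiv_class_self[OF equiv_axis_permutation] by (auto elim!: quotientE)
  moreover have "finite ?Q" unfolding nontrivial_classes[OF assms(1)] using assms(3) by simp
  ultimately show ?thesis
    by (simp add: num_possible_equilibria_def card_nontrivial_classes[OF assms(1)])
qed

lemma two_nontrivial_equilibria_iff:
  assumes "0 < mu"
  shows "two_nontrivial_equilibria mu tau \<longleftrightarrow> card (solutions mu tau) = 2"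
  using nontrivial_classes[OF assms] card_nontrivial_classes[OF assms]
  by (simp add: two_nontrivial_equilibria_def)

subsection \<open>Probabilities\<close>

text \<open>Off the finite set \<open>B\<close> the predicate is membership in \<open>I\<close>; on
  \<open>B\<close> it may be anything, since finite sets are Borel and null. Positivity of
  \<open>X\<close> and vanishing of \<open>g\<close> on the nonpositive axis allow \<open>I\<close>
  to reach below 0.\<close>

lemma
  fixes g :: "real \<Rightarrow> real"
  assumes X: "distributed M lborel X (\<lambda>u. ennreal (g u))" and g: "\<And>u. 0 \<le> g u" "\<And>u. u \<le> 0 \<Longrightarrow> g u = 0"
    and pos: "\<And>w. w \<in> space M \<Longrightarrow> 0 < X w"
    and B: "finite B" and I: "I \<in> sets borel"
    and P: "\<And>u. 0 < u \<Longrightarrow> u \<notin> B \<Longrightarrow> P u \<longleftrightarrow> u \<in> I"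
  shows sets_distributed_mod_finite: "{w \<in> space M. P (X w)} \<in> sets M"
    and measure_distributed_mod_finite: "measure M {w \<in> space M. P (X w)} = (\<integral>u\<in>I. g u \<partial>lborel)"
proof -
  define S where "S = {u. 0 < u \<and> P u}"
  have "S = (I \<inter> {0<..} - B) \<union> (S \<inter> B)" using P by (auto simp: S_def)
  moreover have "B \<in> sets borel" "S \<inter> B \<in> sets borel" using B by (auto intro: borel_closed finite_imp_closed)
  ultimately have S: "S \<in> sets borel" using I by (metis sets.Diff sets.Int sets.Un open_greaterThan borel_open)
  have eq: "{w \<in> space M. P (X w)} = X -` S \<inter> space M" using pos by (auto simp: S_def)
  have "X \<in> measurable M lborel" using X by (simp add: distributed_def)
  then show "{w \<in> space M. P (X w)} \<in> sets M"
    unfolding eq using S by (auto intro: measurable_sets)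
  have gm: "g \<in> borel_measurable lborel" using g(1) X by (rule distributed_real_measurable)
  have "AE u in lborel. u \<notin> B"
    using B by (intro AE_not_in) (simp add: countable_imp_null_set_lborel countable_finite)
  then have "AE u in lborel. ennreal (g u) * indicator S u = ennreal (indicator I u *\<^sub>R g u)"
  proof eventually_elim
    case (elim u)
    then show ?case using P[of u] g(2)[of u] by (cases "0 < u") (auto simp: S_def)
  qed
  then have "emeasure M (X -` S \<inter> space M) = (\<integral>\<^sup>+u. ennreal (indicator I u *\<^sub>R g u) \<partial>lborel)"
    using distributed_emeasure[OF X, of S] S by (simp add: nn_integral_cong_AE)
  then have "measure M {w \<in> space M. P (X w)} = enn2real (\<integral>\<^sup>+u. ennreal (indicator I u *\<^sub>R g u) \<partial>lborel)"
    by (simp add: measure_def eq)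
  also have "\<dots> = (\<integral>u\<in>I. g u \<partial>lborel)"
    unfolding set_lebesgue_integral_def
    using I gm g(1) by (intro integral_eq_nn_integral[symmetric]) auto
  finally show "measure M {w \<in> space M. P (X w)} = (\<integral>u\<in>I. g u \<partial>lborel)" .
qed

lemma gamma_density_nonneg: "0 < r1 \<Longrightarrow> 0 \<le> gamma_density r1 r2 u"
  by (simp add: gamma_density_def Gamma_real_nonneg less_imp_le)

lemma gamma_density_nonpos: "u \<le> 0 \<Longrightarrow> gamma_density r1 r2 u = 0"
  by (simp add: gamma_density_def)

text \<open>Cubing reduces the claim to 27/8 < 4. The order makes the range of three equilibria
  nonempty and places every modulus above the upper threshold in the stable range.\<close>

lemma threshold_order:
  assumes "0 < (tau :: real)"
  shows "tau / 2 < 2 powr (2 / 3) * tau / 3"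
proof -
  have "((2::real) powr (2 / 3)) ^ 3 = (2 powr (2 / 3)) powr 3" by (rule powr_numeral[symmetric]) simp
  also have "\<dots> = 4" unfolding powr_powr by simp
  finally have "(3 / 2 :: real) ^ 3 < (2 powr (2 / 3)) ^ 3" by (simp add: power3_eq_cube)
  then have "3 / 2 < (2 :: real) powr (2 / 3)" by (rule power_less_imp_less_base) simp
  then have "3 / 2 * tau < 2 powr (2 / 3) * tau" using assms by (rule mult_strict_right_mono)
  then show ?thesis by simp
qed

section \<open>The three ranges of the shear modulus\<close>

lemma outcome_one:
  fixes mu tau :: real
  assumes mu: "0 < mu" and tau: "0 < tau" and range: "2 powr (2 / 3) * tau / 3 < mu"
  shows "equilibria mu tau = {reference}" "stable_deformation mu tau (triaxial reference)"
    "num_possible_equilibria mu tau = 1"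
proof -
  have none: "solutions mu tau = {}"
    using range mu by (intro solutions_empty) (simp_all add: field_simps)
  have "l = reference" if "l \<in> equilibria mu tau" for l
  proof (rule ccontr)
    assume "l \<noteq> reference"
    then have "l \<in> equilibria mu tau - {reference}" using that by simp
    then obtain x where "x \<in> solutions mu tau" by (rule nontrivial_equilibrium_uniaxial[OF mu])
    then show False using none by simp
  qed
  then show "equilibria mu tau = {reference}" using reference_equilibrium by blast
  show stable: "stable_deformation mu tau (triaxial reference)"
  proof (rule reference_stable[OF tau])
    have "tau / 2 < mu" using threshold_order[OF tau] range by linarith
    then show "tau < 2 * mu" by simp
  qed
  show "num_possible_equilibria mu tau = 1"
    using num_possible_stable[OF mu stable] none by simp
qed

lemma outcome_two:
  fixes mu tau :: real
  assumes mu: "0 < mu" and tau: "0 < tau" and range: "mu < tau / 2"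
  shows "unstable_deformation mu tau (triaxial reference)" "two_nontrivial_equilibria mu tau"
    "num_possible_equilibria mu tau = 2"
proof -
  have "3 * mu / 2 powr (2 / 3) < tau"
    using range threshold_order[OF tau] by (simp add: field_simps)
  then have two: "card (solutions mu tau) = 2" using range mu by (intro card_solutions) simp_all
  show unstable: "unstable_deformation mu tau (triaxial reference)"
    using range mu by (intro reference_unstable) simp_all
  then have "\<not> stable_deformation mu tau (triaxial reference)"
    unfolding unstable_deformation_def stable_deformation_def by (meson less_imp_le)
  then show "num_possible_equilibria mu tau = 2" using num_possible_unstable[OF mu] two by simp
  show "two_nontrivial_equilibria mu tau" using two by (simp add: two_nontrivial_equilibria_iff[OF mu])
qed

lemma outcome_three:
  fixes mu tau :: real
  assumes mu: "0 < mu" and tau: "0 < tau" and range: "tau / 2 < mu" "mu < 2 powr (2 / 3) * tau / 3"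
  shows "stable_deformation mu tau (triaxial reference)" "two_nontrivial_equilibria mu tau"
    "num_possible_equilibria mu tau = 3"
proof -
  have "3 * mu / 2 powr (2 / 3) < tau" using range by (simp add: field_simps)
  then have two: "card (solutions mu tau) = 2" using range mu by (intro card_solutions) simp_all
  show stable: "stable_deformation mu tau (triaxial reference)"
    using range tau by (intro reference_stable) simp_all
  have "finite (solutions mu tau)" using two by (simp add: card_ge_0_finite)
  then show "num_possible_equilibria mu tau = 3" using num_possible_stable[OF mu stable] two by simp
  show "two_nontrivial_equilibria mu tau" using two by (simp add: two_nontrivial_equilibria_iff[OF mu])
qed

theorem mainTheorem4:
  fixes M :: "'a measure" and mu :: "'a \<Rightarrow> real" and rho1 rho2 tau :: real
  assumes "prob_space M"
    and "rho1 > 0" and "rho2 > 0" and "tau > 0"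
    and "distributed M lborel mu (\<lambda>u. ennreal (gamma_density rho1 rho2 u))"
    and "\<And>w. w \<in> space M \<Longrightarrow> 0 < mu w"
  shows
    "(let c1 = (\<lambda>w. tau < 3 * mu w / 2 powr (2/3));
          c2 = (\<lambda>w. 0 < 2 * mu w \<and> 2 * mu w < tau);
          c3 = (\<lambda>w. 3 * mu w / 2 powr (2/3) < tau \<and> tau < 2 * mu w);
          P = (\<lambda>k. measure M {w \<in> space M. num_possible_equilibria (mu w) tau = k});
          g = gamma_density rho1 rho2
      in
        (AE w in M. (c1 w \<and> \<not> c2 w \<and> \<not> c3 w) \<or> (\<not> c1 w \<and> c2 w \<and> \<not> c3 w) \<or>
                    (\<not> c1 w \<and> \<not> c2 w \<and> c3 w)) \<and>
        (\<forall>w\<in>space M.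
          (c1 w \<longleftrightarrow> 2 powr (2/3) * tau / 3 < mu w) \<and>
          (c2 w \<longleftrightarrow> 0 < mu w \<and> mu w < tau / 2) \<and>
          (c3 w \<longleftrightarrow> tau / 2 < mu w \<and> mu w < 2 powr (2/3) * tau / 3) \<and>
          (c1 w \<longrightarrow> equilibria (mu w) tau = {reference} \<and>
                    stable_deformation (mu w) tau (triaxial reference) \<and>
                    num_possible_equilibria (mu w) tau = 1) \<and>
          (c2 w \<longrightarrow> unstable_deformation (mu w) tau (triaxial reference) \<and>
                    two_nontrivial_equilibria (mu w) tau \<and>
                    num_possible_equilibria (mu w) tau = 2) \<and>
          (c3 w \<longrightarrow> reference \<in> equilibria (mu w) tau \<and>
                    stable_deformation (mu w) tau (triaxial reference) \<and>
                    two_nontrivial_equilibria (mu w) tau \<and>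
                    num_possible_equilibria (mu w) tau = 3)) \<and>
        P 1 = 1 - (\<integral>u\<in>{0..2 powr (2/3) * tau / 3}. g u \<partial>lborel) \<and>
        P 2 = (\<integral>u\<in>{0..tau / 2}. g u \<partial>lborel) \<and>
        P 3 = 1 - P 1 - P 2 \<and>
        P 3 = (\<integral>u\<in>{tau / 2..2 powr (2/3) * tau / 3}. g u \<partial>lborel))"
proof -
  interpret prob_space M by fact
  note tau = \<open>tau > 0\<close> and pos = assms(6)
  define b where "b = 2 powr (2/3) * tau / 3"
  have b: "0 < tau / 2" "tau / 2 < b" using threshold_order[OF tau] tau by (simp_all add: b_def)
  define N where "N u = num_possible_equilibria u tau" for u
  have N1: "N u = 1" if "b < u" for u
    unfolding N_def using outcome_one(3)[of u tau] that b tau by (simp add: b_def)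
  have N2: "N u = 2" if "0 < u" "u < tau / 2" for u
    unfolding N_def using outcome_two(3)[of u tau] that tau by simp
  have N3: "N u = 3" if "tau / 2 < u" "u < b" for u
    unfolding N_def using outcome_three(3)[of u tau] that b tau by (simp add: b_def)
  have N: "N u = (if b < u then 1 else if u < tau / 2 then 2 else 3)"
    if "0 < u" "u \<notin> {tau / 2, b}" for u
    using N1[of u] N2[of u] N3[of u] that by auto
  note law = assms(5) gamma_density_nonneg[OF assms(2)] gamma_density_nonpos pos
  note mod = measure_distributed_mod_finite[OF law, of "{tau / 2, b}"]
    and sets_mod = sets_distributed_mod_finite[OF law, of "{tau / 2, b}"]
  have P2: "prob {w \<in> space M. N (mu w) = 2} = (\<integral>u\<in>{0..tau / 2}. gamma_density rho1 rho2 u \<partial>lborel)"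
    and P2_sets: "{w \<in> space M. N (mu w) = 2} \<in> events"
    using b by (intro mod sets_mod[where I = "{0..tau / 2}"]; auto simp: N)+
  have P3: "prob {w \<in> space M. N (mu w) = 3} = (\<integral>u\<in>{tau / 2..b}. gamma_density rho1 rho2 u \<partial>lborel)"
    and P3_sets: "{w \<in> space M. N (mu w) = 3} \<in> events"
    using b by (intro mod sets_mod[where I = "{tau / 2..b}"]; auto simp: N)+
  \<comment> \<open>The first probability is claimed as a complement, so the complementary event,
    with modulus in [0, b] up to thresholds, is measured directly in place of the tail beyond
    \<open>b\<close>.\<close>
  have P23: "prob {w \<in> space M. N (mu w) = 2 \<or> N (mu w) = 3} = (\<integral>u\<in>{0..b}. gamma_density rho1 rho2 u \<partial>lborel)"
    using b by (intro mod; auto simp: N)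
  have P1_sets: "{w \<in> space M. N (mu w) = 1} \<in> events"
    using b by (intro sets_mod[where I = "{b..}"]; auto simp: N)
  \<comment> \<open>Off the thresholds this predicate is false, so the integration set is empty and
    the thresholds form a null event.\<close>
  have boundary: "prob {w \<in> space M. mu w \<in> {tau / 2, b}} = (\<integral>u\<in>{}. gamma_density rho1 rho2 u \<partial>lborel)"
    and boundary_sets: "{w \<in> space M. mu w \<in> {tau / 2, b}} \<in> events"
    by (intro mod sets_mod[where I = "{}"]; auto)+
  have generic: "AE w in M. mu w \<notin> {tau / 2, b}"
    using prob_eq_0[OF boundary_sets] boundary by (simp add: set_lebesgue_integral_def AE_conj_iff)
  have total: "prob {w \<in> space M. N (mu w) = 1} + prob {w \<in> space M. N (mu w) = 2 \<or> N (mu w) = 3} = 1"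
  proof -
    have "AE w in M. w \<in> {w \<in> space M. N (mu w) = 1} \<union> {w \<in> space M. N (mu w) = 2 \<or> N (mu w) = 3}"
      using generic AE_space by eventually_elim (use N pos in auto)
    moreover have 23: "{w \<in> space M. N (mu w) = 2 \<or> N (mu w) = 3} \<in> events"
      using sets.Un[OF P2_sets P3_sets] by (simp add: Collect_disj_eq Int_Un_distrib Collect_conj_eq)
    ultimately have "prob ({w \<in> space M. N (mu w) = 1} \<union> {w \<in> space M. N (mu w) = 2 \<or> N (mu w) = 3}) = 1"
      using P1_sets by (subst prob_eq_1) auto
    then show ?thesis using P1_sets 23 by (subst (asm) finite_measure_Union) auto
  qed
  have split: "prob {w \<in> space M. N (mu w) = 2 \<or> N (mu w) = 3}
      = prob {w \<in> space M. N (mu w) = 2} + prob {w \<in> space M. N (mu w) = 3}"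
  proof -
    have "{w \<in> space M. N (mu w) = 2 \<or> N (mu w) = 3}
      = {w \<in> space M. N (mu w) = 2} \<union> {w \<in> space M. N (mu w) = 3}" by auto
    then show ?thesis using P2_sets P3_sets by (simp add: finite_measure_Union disjoint_iff)
  qed
  have c1: "tau < 3 * u / 2 powr (2/3) \<longleftrightarrow> b < u"
    and c3: "3 * u / 2 powr (2/3) < tau \<longleftrightarrow> u < b" for u
    by (simp_all add: b_def field_simps)
  have trichotomy: "AE w in M. (b < mu w \<and> \<not> (0 < 2 * mu w \<and> 2 * mu w < tau) \<and> \<not> (mu w < b \<and> tau < 2 * mu w)) \<or>
      (\<not> b < mu w \<and> (0 < 2 * mu w \<and> 2 * mu w < tau) \<and> \<not> (mu w < b \<and> tau < 2 * mu w)) \<or>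
      (\<not> b < mu w \<and> \<not> (0 < 2 * mu w \<and> 2 * mu w < tau) \<and> (mu w < b \<and> tau < 2 * mu w))"
    using generic AE_space by eventually_elim (use b pos in force)
  have cases: "\<forall>w\<in>space M.
      (b < mu w \<longrightarrow> equilibria (mu w) tau = {reference} \<and>
         stable_deformation (mu w) tau (triaxial reference) \<and> N (mu w) = 1) \<and>
      (0 < 2 * mu w \<and> 2 * mu w < tau \<longrightarrow> unstable_deformation (mu w) tau (triaxial reference) \<and>
         two_nontrivial_equilibria (mu w) tau \<and> N (mu w) = 2) \<and>
      (mu w < b \<and> tau < 2 * mu w \<longrightarrow> reference \<in> equilibria (mu w) tau \<and>
         stable_deformation (mu w) tau (triaxial reference) \<and>
         two_nontrivial_equilibria (mu w) tau \<and> N (mu w) = 3)"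
  proof (intro ballI conjI impI)
    fix w assume w: "w \<in> space M"
    note o = outcome_one[OF pos[OF w] tau, folded b_def N_def] outcome_two[OF pos[OF w] tau, folded N_def]
      outcome_three[OF pos[OF w] tau, folded b_def N_def]
    show "equilibria (mu w) tau = {reference}" "stable_deformation (mu w) tau (triaxial reference)"
      "N (mu w) = 1" if "b < mu w" using o that by blast+
    show "unstable_deformation (mu w) tau (triaxial reference)" "two_nontrivial_equilibria (mu w) tau"
      "N (mu w) = 2" if "0 < 2 * mu w \<and> 2 * mu w < tau" using o that by simp_all
    show "reference \<in> equilibria (mu w) tau" by (rule reference_equilibrium)
    show "stable_deformation (mu w) tau (triaxial reference)" "two_nontrivial_equilibria (mu w) tau"
      "N (mu w) = 3" if "mu w < b \<and> tau < 2 * mu w" using o that by simp_all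
  qed
  have c2': "0 < 2 * u \<and> 2 * u < tau \<longleftrightarrow> 0 < u \<and> u < tau / 2"
    and c3': "u < b \<and> tau < 2 * u \<longleftrightarrow> tau / 2 < u \<and> u < b" for u by auto
  show ?thesis
    unfolding Let_def c1 c3 b_def[symmetric] N_def[symmetric]
  proof (intro conjI trichotomy)
    show "\<forall>w\<in>space M. (b < mu w \<longleftrightarrow> b < mu w) \<and>
        (0 < 2 * mu w \<and> 2 * mu w < tau \<longleftrightarrow> 0 < mu w \<and> mu w < tau / 2) \<and>
        (mu w < b \<and> tau < 2 * mu w \<longleftrightarrow> tau / 2 < mu w \<and> mu w < b) \<and>
        (b < mu w \<longrightarrow> equilibria (mu w) tau = {reference} \<and>
           stable_deformation (mu w) tau (triaxial reference) \<and> N (mu w) = 1) \<and>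
        (0 < 2 * mu w \<and> 2 * mu w < tau \<longrightarrow> unstable_deformation (mu w) tau (triaxial reference) \<and>
           two_nontrivial_equilibria (mu w) tau \<and> N (mu w) = 2) \<and>
        (mu w < b \<and> tau < 2 * mu w \<longrightarrow> reference \<in> equilibria (mu w) tau \<and>
           stable_deformation (mu w) tau (triaxial reference) \<and>
           two_nontrivial_equilibria (mu w) tau \<and> N (mu w) = 3)"
      using cases c2' c3' by blast
  qed (use P2 P3 P23 total split in simp_all)
qed

end
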